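(* Let $(T_n)_{n\in\mathbb{N}}$ be a BST sequence and let $s_1,\ldots,s_d$ with $0\le s_1<\cdots<s_d\le 1$ be given. Then the $d$-dimensional random vectors $Y_n=(Y_{n,1},\ldots,Y_{n,d})$ with $$Y_{n,l}:=\frac{X(T_n,s_l)-\log n}{\sqrt{\log n}}\qquad\text{for } l=1,\ldots,d$$ converge in distribution as $n\to\infty$ to a $d$-dimensional standard normal limit. Here $X(T,s)$ is the value at $s$ of the silhouette of the binary tree $T$.
   Context: Nodes are the finite words over $\{0,1\}$, i.e. elements of $\mathcal{N}:=\bigcup_{k\ge 0}\{0,1\}^k$, including the empty word (the root). A binary tree is a finite, prefix-stable set $T\subset\mathcal{N}$: if $(u_1,\ldots,u_k)\in T$ with $k\ge1$, then $(u_1,\ldots,u_{k-1})\in T$. BST sequence: let $(\xi_n)_{n\in\mathbb{N}}$ be independent random variables, uniformly distributed on the unit interval. $T_1$ consists only of the root, with label $\xi_1$. Given $T_n$ with its labels, $T_{n+1}$ is obtained as follows: start at the root; at a node $u\in T_n$ move to $(u,0)$ (left) if $\xi_{n+1}$ is smaller than the label of $u$ and to $(u,1)$ (right) if it is greater; the first node reached that is not in $T_n$ is added to the tree and receives the label $\xi_{n+1}$. The sequence $(T_n)_{n\in\mathbb{N}}$ of random binary trees (with labels ignored) is called a BST sequence. Silhouette: each $s\in[0,1]$ has a binary expansion $s=\sum_{k\ge1}u_k2^{-k}$, $u_k\in\{0,1\}$, made unique by requiring that for binary rationals $s<1$ one has $u_k=0$ for all sufficiently large $k$ (for $s=1$ all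 $u_k=1$). For a binary tree $T$ put $X_s(T)=X(T,s):=\min\{k\in\mathbb{N}_0:(u_1,\ldots,u_k)\notin T\}$. *)

theory Defs
  imports "HOL-Probability.Probability"
begin

text \<open>The letters \<open>0\<close> and \<open>1\<close> are \<^term>\<open>False\<close> and \<^term>\<open>True\<close>; the word
  \<open>(u\<^sub>1, \<dots>, u\<^sub>k)\<close> is the list with head \<open>u\<^sub>1\<close>, so that children are formed by appending at the
  end of the list.\<close>

type_synonym node = "bool list"

definition binary_tree :: "node set \<Rightarrow> bool" where
  "binary_tree T \<longleftrightarrow> finite T \<and> (\<forall>u b. u @ [b] \<in> T \<longrightarrow> u \<in> T)"

text \<open>Sequences of binary digits are indexed from \<open>0\<close>: the value \<open>u k\<close> is the digit with
  weight \<open>2 ^ -(k + 1)\<close>. Expansions ending in \<open>111\<dots>\<close> are excluded for dyadic \<open>s < 1\<close>.\<close>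

definition is_binary_expansion :: "real \<Rightarrow> (nat \<Rightarrow> bool) \<Rightarrow> bool" where
  "is_binary_expansion s u \<longleftrightarrow>
     (\<lambda>k. of_bool (u k) / 2 ^ Suc k) sums s \<and>
     (s < 1 \<and> (\<exists>m k :: nat. s = real m / 2 ^ k) \<longrightarrow> (\<forall>\<^sub>F k in sequentially. \<not> u k))"

definition binary_digits :: "real \<Rightarrow> nat \<Rightarrow> bool" where
  "binary_digits s = (THE u. is_binary_expansion s u)"

definition silhouette :: "node set \<Rightarrow> real \<Rightarrow> nat" where
  "silhouette T s = (LEAST k. map (binary_digits s) [0..<k] \<notin> T)"

text \<open>A labelled tree is a partial function from nodes to labels, whose domain is the tree.
  \<open>bst_path L x k\<close> is the node reached after \<open>k\<close> moves from the root when \<open>x\<close> is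
  inserted; it is only meaningful up to the first node outside the domain. A label equal to \<open>x\<close>
  sends \<open>x\<close> to the left: this is an arbitrary choice, as for independent uniform
  keys ties have probability zero.\<close>

type_synonym labelled_tree = "node \<rightharpoonup> real"

primrec bst_path :: "labelled_tree \<Rightarrow> real \<Rightarrow> nat \<Rightarrow> node" where
  "bst_path L x 0 = []"
| "bst_path L x (Suc k) = bst_path L x k @ [the (L (bst_path L x k)) < x]"

definition bst_new_node :: "labelled_tree \<Rightarrow> real \<Rightarrow> node" where
  "bst_new_node L x = bst_path L x (LEAST k. bst_path L x k \<notin> dom L)"

definition bst_insert :: "real \<Rightarrow> labelled_tree \<Rightarrow> labelled_tree" where
  "bst_insert x L = L(bst_new_node L x \<mapsto> x)"

text \<open>\<open>bst_of_keys x n\<close> is the labelled tree obtained from the keys \<open>x 1, \<dots>, x n\<close>; the value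
  \<open>x 0\<close> is not used.\<close>

primrec bst_of_keys :: "(nat \<Rightarrow> real) \<Rightarrow> nat \<Rightarrow> labelled_tree" where
  "bst_of_keys x 0 = Map.empty"
| "bst_of_keys x (Suc n) = bst_insert (x (Suc n)) (bst_of_keys x n)"

definition BST_sequence :: "'a measure \<Rightarrow> (nat \<Rightarrow> 'a \<Rightarrow> node set) \<Rightarrow> bool" where
  "BST_sequence M T \<longleftrightarrow>
     prob_space M \<and>
     (\<exists>\<xi> :: nat \<Rightarrow> 'a \<Rightarrow> real.
        prob_space.indep_vars M (\<lambda>_. borel) \<xi> {1..} \<and>
        (\<forall>n\<ge>1. distr M lborel (\<xi> n) = uniform_measure lborel {0..1}) \<and>
        (\<forall>n\<ge>1. \<forall>\<omega>\<in>space M. T n \<omega> = dom (bst_of_keys (\<lambda>i. \<xi> i \<omega>) n)))"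

text \<open>The library's \<^const>\<open>weak_conv_m\<close> is restricted to measures on the real line.\<close>

definition converges_in_distribution ::
    "'a measure \<Rightarrow> (nat \<Rightarrow> 'a \<Rightarrow> 'b::topological_space) \<Rightarrow> 'b measure \<Rightarrow> bool" where
  "converges_in_distribution M Y N \<longleftrightarrow>
     (\<forall>f :: 'b \<Rightarrow> real. continuous_on UNIV f \<and> bounded (range f) \<longrightarrow>
        (\<lambda>n. \<integral>y. f y \<partial>distr M borel (Y n)) \<longlonglongrightarrow> (\<integral>y. f y \<partial>N))"

definition std_normal_vec :: "(real ^ 'd) measure" where
  "std_normal_vec = density lborel (\<lambda>x. ennreal (\<Prod>l\<in>UNIV. std_normal_density (x $ l)))"

lemma dom_bst_insert: "dom (bst_insert x L) = insert (bst_new_node L x) (dom L)"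
  unfolding bst_insert_def by (subst dom_fun_upd) simp

lemma bst_1: "bst_of_keys x 1 = [[] \<mapsto> x 1]"
  by (simp add: bst_insert_def bst_new_node_def)

lemma length_bst_path: "length (bst_path L x k) = k"
  by (induction k) auto

lemma bst_path_leaves:
  assumes "finite (dom L)"
  shows "\<exists>k. bst_path L x k \<notin> dom L"
proof (rule ccontr)
  assume "\<not> ?thesis"
  hence "range (bst_path L x) \<subseteq> dom L" by auto
  moreover have "inj (bst_path L x)"
    by (metis injI length_bst_path)
  ultimately show False
    using assms finite_subset finite_imageD infinite_UNIV_nat by blast
qed

lemma bst_new_node_notin:
  assumes "finite (dom L)"
  shows "bst_new_node L x \<notin> dom L"
  unfolding bst_new_node_def by (rule LeastI_ex[OF bst_path_leaves[OF assms]])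

lemma binary_tree_bst: "binary_tree (dom (bst_of_keys x n))"
proof (induction n)
  case 0
  show ?case by (simp add: binary_tree_def)
next
  case (Suc n)
  let ?L = "bst_of_keys x n" and ?y = "x (Suc n)"
  have "u \<in> dom ?L" if "bst_new_node ?L ?y = u @ [b]" for u b
  proof -
    define m where "m = (LEAST k. bst_path ?L ?y k \<notin> dom ?L)"
    have eq: "bst_path ?L ?y m = u @ [b]" using that by (simp add: bst_new_node_def m_def)
    then obtain k where k: "m = Suc k" by (cases m) auto
    have "bst_path ?L ?y k \<in> dom ?L"
      using not_less_Least[of k "\<lambda>k. bst_path ?L ?y k \<notin> dom ?L"] k m_def by auto
    thus ?thesis using eq k by auto
  qed
  thus ?case using Suc by (simp add: binary_tree_def dom_bst_insert) metis
qed

lemma card_bst: "card (dom (bst_of_keys x n)) = n"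
proof (induction n)
  case (Suc n)
  have "finite (dom (bst_of_keys x n))" using binary_tree_bst by (auto simp: binary_tree_def)
  thus ?case using Suc bst_new_node_notin by (simp add: dom_bst_insert)
qed simp

lemma ex1_binary_expansion:
  assumes "0 \<le> s" "s \<le> 1"
  shows "\<exists>!u. is_binary_expansion s u"
proof -
  define S where "S u K = (\<Sum>k<K. of_bool (u k) / 2 ^ Suc k :: real)" for u :: "nat \<Rightarrow> bool" and K
  define P where "P u t \<longleftrightarrow> (\<lambda>k. of_bool (u k) / 2 ^ Suc k :: real) sums t" for u t
  have S_nat: "\<exists>m::nat. S u K = m / 2 ^ K \<and> S u (Suc K) = (2 * m + of_bool (u K)) / 2 ^ Suc K" for u K
  proof (induction K)
    case 0
    show ?case by (rule exI[of _ 0]) (simp add: S_def)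
  next
    case (Suc K)
    then obtain m :: nat where "S u (Suc K) = (2 * m + of_bool (u K)) / 2 ^ Suc K" by auto
    thus ?case
      by (intro exI[of _ "2 * m + of_bool (u K)"]) (simp add: S_def field_simps)
  qed
  have S_le: "S u K \<le> t" if "P u t" for u K t
    using that sum_le_suminf[of "\<lambda>k. of_bool (u k) / 2 ^ Suc k :: real" "{..<K}"]
    by (auto simp: S_def P_def sums_iff)
  have S_less: "S u K < t" if "P u t" "u j" "j \<ge> K" for u K t j
  proof -
    have "S u K \<le> S u j" unfolding S_def by (rule sum_mono2) (use that in auto)
    also have "\<dots> < S u (Suc j)" using that by (simp add: S_def)
    also have "\<dots> \<le> t" using S_le that by blast
    finally show ?thesis .
  qed
  have compl: "P (\<lambda>k. \<not> u k) (1 - t)" if "P u t" for u t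
  proof -
    have "(\<lambda>k. (1/2) ^ Suc k - of_bool (u k) / 2 ^ Suc k :: real) sums (1 - t)"
      using that unfolding P_def by (intro sums_diff power_half_series)
    moreover have "(1/2) ^ Suc k - of_bool (u k) / 2 ^ Suc k = (of_bool (\<not> u k) / 2 ^ Suc k :: real)" for k
      by (simp add: power_one_over)
    ultimately show ?thesis by (simp add: P_def)
  qed
  have S_compl: "S (\<lambda>k. \<not> u k) K = 1 - 1 / 2 ^ K - S u K" for u K
  proof (induction K)
    case (Suc K)
    have "S (\<lambda>k. \<not> u k) (Suc K) = S (\<lambda>k. \<not> u k) K + of_bool (\<not> u K) / 2 ^ Suc K"
      "S u (Suc K) = S u K + of_bool (u K) / 2 ^ Suc K" by (simp_all add: S_def)
    thus ?case using Suc by (cases "u K") simp_all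
  qed (simp add: S_def)
  have unique1: "u k" if "P u 1" for u k
    using S_less[OF compl[OF that], of k 0] by (auto simp: S_def)
  have unique: "u k \<longleftrightarrow> odd \<lfloor>2 ^ Suc k * s\<rfloor>" if "is_binary_expansion s u" "s < 1" for u k
  proof -
    have Pu: "P u s" using that by (auto simp: P_def is_binary_expansion_def)
    have inf: "\<exists>j\<ge>K. \<not> u j" for K
    proof (rule ccontr)
      assume *: "\<not> ?thesis"
      have "eventually u sequentially" using * by (auto simp: eventually_at_top_linorder)
      have S_eq: "S u K' = S u K + 1 / 2 ^ K - 1 / 2 ^ K'" if "K' \<ge> K" for K'
        using that by (induction K' rule: dec_induct) (use * in \<open>simp_all add: S_def\<close>)
      have "eventually (\<lambda>K'. S u K + 1 / 2 ^ K - (1/2) ^ K' = S u K') sequentially"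
        unfolding power_one_over by (intro eventually_sequentiallyI[of K] S_eq[symmetric])
      moreover have "(\<lambda>K'. S u K + 1 / 2 ^ K - (1/2) ^ K') \<longlonglongrightarrow> S u K + 1 / 2 ^ K - 0"
        by (intro tendsto_intros LIMSEQ_realpow_zero) auto
      ultimately have "S u \<longlonglongrightarrow> S u K + 1 / 2 ^ K - 0"
        by (rule Lim_transform_eventually[rotated])
      moreover have "S u \<longlonglongrightarrow> s"
        using Pu by (simp add: P_def sums_def S_def[abs_def])
      ultimately have eq: "s = S u K + 1 / 2 ^ K" using LIMSEQ_unique by fastforce
      obtain m :: nat where "S u K = m / 2 ^ K" using S_nat by blast
      hence "s = real (m + 1) / 2 ^ K" using eq by (simp add: add_divide_distrib)
      hence "eventually (\<lambda>k. \<not> u k) sequentially"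
        using that unfolding is_binary_expansion_def by blast
      hence "eventually (\<lambda>k::nat. False) sequentially"
        using \<open>eventually u sequentially\<close> by eventually_elim auto
      thus False by simp
    qed
    have less: "s < S u K + 1 / 2 ^ K" for K
    proof -
      obtain j where "j \<ge> K" "\<not> u j" using inf by blast
      hence "S (\<lambda>k. \<not> u k) K < 1 - s" using S_less[OF compl[OF Pu]] by blast
      thus ?thesis by (simp add: S_compl)
    qed
    obtain m :: nat where m: "S u (Suc k) = (2 * real m + of_bool (u k)) / 2 ^ Suc k"
      using S_nat by blast
    have "\<lfloor>2 ^ Suc k * s\<rfloor> = 2 * int m + of_bool (u k)"
      using S_le[OF Pu, of "Suc k"] less[of "Suc k"] unfolding m
      by (intro floor_unique) (auto simp: field_simps)
    thus ?thesis by simp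
  qed
  have ex: "is_binary_expansion s (\<lambda>k. odd \<lfloor>2 ^ Suc k * s\<rfloor>)" if "s < 1"
  proof -
    let ?u = "\<lambda>k. odd \<lfloor>2 ^ Suc k * s\<rfloor>"
    have dbl: "\<lfloor>2 * y\<rfloor> = 2 * \<lfloor>y\<rfloor> + of_bool (odd \<lfloor>2 * y\<rfloor>)" for y :: real
    proof -
      have "\<lfloor>2 * y\<rfloor> div 2 = \<lfloor>y\<rfloor>"
        using floor_divide_real_eq_div[of 2 "2 * y"] by simp
      moreover have "2 * (\<lfloor>2 * y\<rfloor> div 2) + of_bool (odd \<lfloor>2 * y\<rfloor>) = \<lfloor>2 * y\<rfloor>"
        unfolding of_bool_odd_eq_mod_2 by (rule mult_div_mod_eq)
      ultimately show ?thesis by (simp only:)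
    qed
    have S: "S ?u K = \<lfloor>2 ^ K * s\<rfloor> / 2 ^ K" for K
    proof (induction K)
      case 0
      have "\<lfloor>s\<rfloor> = 0" using that assms by (simp add: floor_eq_iff)
      thus ?case by (simp add: S_def)
    next
      case (Suc K)
      have "S ?u (Suc K) = (2 * \<lfloor>2 ^ K * s\<rfloor> + of_bool (?u K)) / 2 ^ Suc K"
        using Suc by (simp add: S_def field_simps)
      also have "2 * \<lfloor>2 ^ K * s\<rfloor> + of_bool (?u K) = \<lfloor>2 ^ Suc K * s\<rfloor>"
        using dbl[of "2 ^ K * s"] by (simp add: mult.assoc)
      finally show ?case .
    qed
    have "S ?u \<longlonglongrightarrow> s"
    proof (rule tendsto_sandwich)
      show "\<forall>\<^sub>F K in sequentially. s - (1/2) ^ K \<le> S ?u K"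
      proof (intro always_eventually allI)
        fix K
        have "2 ^ K * s - 1 \<le> \<lfloor>2 ^ K * s\<rfloor>" by linarith
        hence "(2 ^ K * s - 1) / 2 ^ K \<le> \<lfloor>2 ^ K * s\<rfloor> / 2 ^ K" by (rule divide_right_mono) simp
        thus "s - (1/2) ^ K \<le> S ?u K" unfolding S by (simp add: diff_divide_distrib power_one_over)
      qed
      show "\<forall>\<^sub>F K in sequentially. S ?u K \<le> s"
      proof (intro always_eventually allI)
        fix K
        have "\<lfloor>2 ^ K * s\<rfloor> \<le> 2 ^ K * s" by linarith
        thus "S ?u K \<le> s" unfolding S by (simp add: field_simps)
      qed
      have "(\<lambda>K. s - (1/2) ^ K) \<longlonglongrightarrow> s - 0"
        by (intro tendsto_intros LIMSEQ_realpow_zero) auto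
      thus "(\<lambda>K. s - (1/2) ^ K) \<longlonglongrightarrow> s" by simp
    qed auto
    hence "(\<lambda>k. of_bool (?u k) / 2 ^ Suc k) sums s"
      by (simp add: sums_def S_def[abs_def])
    moreover have "\<forall>\<^sub>F k in sequentially. \<not> ?u k" if "s = real m / 2 ^ k" for m k :: nat
      unfolding eventually_at_top_linorder
    proof (intro exI[of _ k] allI impI)
      fix j assume "j \<ge> k"
      then obtain i where "j = k + i" using le_Suc_ex by blast
      hence "2 ^ Suc j * s = of_int (2 * (2 ^ i * int m))"
        using that by (simp add: power_add field_simps)
      hence "\<lfloor>2 ^ Suc j * s\<rfloor> = 2 * (2 ^ i * int m)" by (simp only: floor_of_int)
      thus "\<not> ?u j" by (simp only: dvd_triv_left not_not)
    qed
    ultimately show ?thesis unfolding is_binary_expansion_def by blast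
  qed
  show ?thesis
  proof (cases "s = 1")
    case True
    have "is_binary_expansion 1 (\<lambda>_. True)"
      using power_half_series by (simp add: is_binary_expansion_def power_one_over)
    moreover have "u = (\<lambda>_. True)" if "is_binary_expansion 1 u" for u
      using that unique1 by (auto simp: is_binary_expansion_def P_def)
    ultimately show ?thesis using True by blast
  next
    case False
    hence "s < 1" using assms by simp
    show ?thesis
    proof (rule ex1I)
      show "is_binary_expansion s (\<lambda>k. odd \<lfloor>2 ^ Suc k * s\<rfloor>)" by (rule ex) fact
      show "u = (\<lambda>k. odd \<lfloor>2 ^ Suc k * s\<rfloor>)" if "is_binary_expansion s u" for u
        by (rule ext) (rule unique[OF that \<open>s < 1\<close>])
    qed
  qed
qed

end

theory Submission
  imports Defs "HOL-Combinatorics.Multiset_Permutations" "HOL-Real_Asymp.Real_Asymp"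
begin

text \<open>
  Write \<open>D\<^sub>n l\<close> for the length of the path that leads along the binary digits of \<open>s l\<close> to the first
  node outside \<open>T\<^sub>n\<close>; this is the silhouette at \<open>s l\<close>. The relative order of \<open>n\<close> independent uniform
  keys is a uniformly random permutation, and a tree with \<open>n\<close> nodes has \<open>n + 1\<close> external nodes, which
  correspond bijectively to the possible ranks of a new key. Hence \<open>T\<^sub>n\<^sub>+\<^sub>1\<close> arises from \<open>T\<^sub>n\<close> by adding a
  uniformly chosen external node (\<open>expectation_tree_Suc\<close>). In this step \<open>D\<^sub>n l\<close> grows by one if the
  chosen node is the one where the path of \<open>s l\<close> leaves the tree, an event of probability
  \<open>1 / (n + 1)\<close>, and stays the same otherwise. So each \<open>D\<^sub>n l\<close> alone is distributed like a sum of
  independent Bernoulli variables with parameters \<open>1 / i\<close>, \<open>i \<le> n\<close>, for which the central limit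
  theorem follows from Levy's continuity theorem (\<open>normalized_record_weak_conv\<close>).

  Once the paths of the distinct points \<open>s l\<close> leave the tree at distinct nodes, the increments for
  different \<open>l\<close> are mutually exclusive, and the law of the vector of increments differs from that of
  independent Bernoulli variables with parameter \<open>1 / (n + 1)\<close> only by \<open>O(n\<^sup>-\<^sup>2)\<close>
  (\<open>step_comparison\<close>). Before that the difference is \<open>O(n\<^sup>-\<^sup>1)\<close>, but some \<open>D\<^sub>n l\<close> is then smaller than a
  fixed \<open>K\<close>, which has probability \<open>O(n\<^sup>-\<^sup>1\<^sup>/\<^sup>2)\<close> because the expectation of \<open>2\<^sup>-\<^sup>D\<close> for \<open>D = D\<^sub>n l\<close> is
  \<open>\<Prod>i=1..n. (1 - 1 / (2 * i))\<close>. The increments from time \<open>m\<close> on are now replaced one after the other, as in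
  Lindeberg's method, by independent ones. The total error is at most a constant times the tail
  \<open>\<Sum>i>m. i\<^sup>-\<^sup>3\<^sup>/\<^sup>2\<close>, uniformly in \<open>n\<close> (\<open>interpolant_diff\<close>). For fixed \<open>m\<close> the modified vector is \<open>D\<^sub>m\<close>
  plus a vector with independent components, and \<open>D\<^sub>m\<close> disappears in the normalisation, so the
  one-dimensional limit theorem yields the standard normal limit as \<open>n \<rightarrow> \<infinity>\<close>. The joint convergence
  of independent components is obtained by representing each of them through Skorohod's theorem on
  its own probability space and taking the product of these spaces (\<open>product_weak_conv\<close>). Finally
  let \<open>m \<rightarrow> \<infinity>\<close>.
\<close>

section \<open>Search trees and their external nodes\<close>

text \<open>Two keys make the same cut in a set of labels if no label separates them. Equality counts as
  in the insertion, where a label equal to the key sends it to the left.\<close>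

definition same_cut :: "real set \<Rightarrow> real \<Rightarrow> real \<Rightarrow> bool" where
  "same_cut V x y \<longleftrightarrow> (\<forall>v\<in>V. v < x \<longleftrightarrow> v < y)"

text \<open>Whenever a labelled node \<open>v\<close> lies at or below the child \<open>w @ [b]\<close> of a node \<open>w\<close>, the node \<open>w\<close> is
  labelled, and \<open>b\<close> is the direction in which the label of \<open>v\<close> leaves \<open>w\<close>.\<close>

definition search_tree :: "labelled_tree \<Rightarrow> bool" where
  "search_tree L \<longleftrightarrow> (\<forall>v\<in>dom L. \<forall>w b r. v = w @ b # r \<longrightarrow> w \<in> dom L \<and> b = (the (L w) < the (L v)))"

text \<open>The nodes at which a binary tree can grow.\<close>

definition external_nodes :: "node set \<Rightarrow> node set" where
  "external_nodes T = {u. u \<notin> T \<and> (u = [] \<or> butlast u \<in> T)}"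

lemma finite_dom_bst: "finite (dom (bst_of_keys x n))"
  using binary_tree_bst[of x n] by (simp add: binary_tree_def)

lemma bst_path_prefix:
  assumes "bst_path L x k = w @ b # r"
  shows "w = bst_path L x (length w)" "b = (the (L w) < x)"
proof -
  have "bst_path L x (length w + Suc (length r)) = w @ b # r \<Longrightarrow> w = bst_path L x (length w) \<and> b = (the (L w) < x)"
  proof (induction r rule: rev_induct)
    case (snoc c r)
    then show ?case by auto
  qed (auto)
  moreover have "k = length w + Suc (length r)"
    using length_bst_path[of L x k] assms by simp
  ultimately show "w = bst_path L x (length w)" "b = (the (L w) < x)" using assms by auto
qed

lemma bst_new_node_path:
  obtains k where "bst_new_node L x = bst_path L x k" "\<And>j. j < k \<Longrightarrow> bst_path L x j \<in> dom L"
  using not_less_Least[of _ "\<lambda>k. bst_path L x k \<notin> dom L"] that unfolding bst_new_node_def by blast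

lemma bst_new_node_prefix:
  assumes "finite (dom L)" "bst_new_node L x = w @ b # r"
  shows "w \<in> dom L" "b = (the (L w) < x)"
proof -
  obtain k where k: "bst_new_node L x = bst_path L x k" "\<And>j. j < k \<Longrightarrow> bst_path L x j \<in> dom L"
    using bst_new_node_path[of L x] by blast
  have eq: "bst_path L x k = w @ b # r" using k assms by simp
  have "length w < k" using length_bst_path[of L x k] eq by simp
  then show "w \<in> dom L" using bst_path_prefix(1)[OF eq] k(2) by metis
  show "b = (the (L w) < x)" using bst_path_prefix(2)[OF eq] .
qed

lemma search_tree_bst: "search_tree (bst_of_keys x n)"
proof (induction n)
  case (Suc n)
  let ?L = "bst_of_keys x n" and ?y = "x (Suc n)"
  let ?u = "bst_new_node ?L ?y"
  have fin: "finite (dom ?L)" by (rule finite_dom_bst)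
  have u: "?u \<notin> dom ?L" by (rule bst_new_node_notin[OF fin])
  show ?case unfolding search_tree_def
  proof (intro ballI allI impI)
    fix v w b r assume v: "v \<in> dom (bst_of_keys x (Suc n))" "v = w @ b # r"
    show "w \<in> dom (bst_of_keys x (Suc n)) \<and> b = (the (bst_of_keys x (Suc n) w) < the (bst_of_keys x (Suc n) v))"
    proof (cases "v = ?u")
      case True
      then have "w \<in> dom ?L" "b = (the (?L w) < ?y)" using bst_new_node_prefix[OF fin] v by metis+
      then show ?thesis using u True by (auto simp: bst_insert_def)
    next
      case False
      then have "v \<in> dom ?L" using v by (auto simp: dom_bst_insert)
      then have *: "w \<in> dom ?L \<and> b = (the (?L w) < the (?L v))" using Suc v by (auto simp: search_tree_def)
      then have "w \<noteq> ?u" using u by auto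
      with * False show ?thesis by (auto simp: bst_insert_def)
    qed
  qed
qed (simp add: search_tree_def)

lemma bool_list_prefix_or_diverge:
  fixes u v :: "bool list"
  obtains "\<exists>r. v = u @ r" | "\<exists>b r. u = v @ b # r" | w b r r' where "u = w @ b # r" "v = w @ (\<not> b) # r'"
proof (induction u arbitrary: v thesis)
  case Nil
  then show ?case by auto
next
  case (Cons a u)
  note C = Cons
  show ?case
  proof (cases v)
    case Nil
    then show ?thesis using C(3) by auto
  next
    case (Cons c v')
    show ?thesis
    proof (cases "a = c")
      case True
      show ?thesis
        apply (rule C(1)[of v'])
        subgoal using C(2) Cons True by auto
        subgoal using C(3) Cons True by auto
        subgoal for w b r r' using C(4)[of "a # w" b r r'] Cons True by auto
        done
    next
      case False
      then show ?thesis using C(4)[of "[]" a u v'] Cons by auto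
    qed
  qed
qed

text \<open>A label separating the two keys would either lie on the common path, or branch off from it at
  a node \<open>w\<close>; in the second case the label of \<open>w\<close> lies between that label and both keys.\<close>

lemma bst_new_node_eq_imp_same_cut:
  assumes L: "finite (dom L)" "search_tree L" and eq: "bst_new_node L x = bst_new_node L y"
  shows "same_cut (ran L) x y"
  unfolding same_cut_def
proof
  fix c assume "c \<in> ran L"
  then obtain v where v: "L v = Some c" by (auto simp: ran_def)
  let ?u = "bst_new_node L x"
  have u: "?u \<notin> dom L" using bst_new_node_notin[OF L(1)] .
  show "c < x \<longleftrightarrow> c < y"
  proof (rule bool_list_prefix_or_diverge[of v ?u])
    assume "\<exists>r. v = ?u @ r"
    then obtain r where r: "v = ?u @ r" by auto
    show ?thesis
    proof (cases r)
      case Nil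
      then show ?thesis using u v r by auto
    next
      case (Cons b r')
      then show ?thesis using u v r L(2) unfolding search_tree_def by blast
    qed
  next
    assume "\<exists>b r. ?u = v @ b # r"
    then obtain b r where r: "?u = v @ b # r" by auto
    have "b = (the (L v) < x)" using bst_new_node_prefix[OF L(1) r] by simp
    moreover have "b = (the (L v) < y)" using bst_new_node_prefix[OF L(1) r[unfolded eq]] by simp
    ultimately show ?thesis using v by simp
  next
    fix w b r r' assume r: "?u = w @ b # r" "v = w @ (\<not> b) # r'"
    have "b = (the (L w) < x)" using bst_new_node_prefix[OF L(1) r(1)] by simp
    moreover have "b = (the (L w) < y)" using bst_new_node_prefix[OF L(1) r(1)[unfolded eq]] by simp
    moreover have "(\<not> b) = (the (L w) < c)" using L(2) v r(2) unfolding search_tree_def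
      by (metis domI option.sel)
    ultimately show ?thesis by auto
  qed
qed

lemma bst_new_node_external:
  assumes "finite (dom L)"
  shows "bst_new_node L x \<in> external_nodes (dom L)"
proof -
  have "butlast (bst_new_node L x) \<in> dom L" if "bst_new_node L x \<noteq> []"
    using that bst_new_node_prefix(1)[OF assms, of x "butlast (bst_new_node L x)" "last (bst_new_node L x)" "[]"] by simp
  then show ?thesis using bst_new_node_notin[OF assms] by (auto simp: external_nodes_def)
qed

lemma external_nodes_insert:
  assumes "binary_tree T" "u \<in> external_nodes T"
  shows "external_nodes (insert u T) = insert (u @ [False]) (insert (u @ [True]) (external_nodes T - {u}))"
proof -
  have *: "v \<in> T \<Longrightarrow> v \<noteq> [] \<Longrightarrow> butlast v \<in> T" for v
    using assms(1) unfolding binary_tree_def by (metis append_butlast_last_id)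
  have u: "u \<notin> T" using assms by (simp add: external_nodes_def)
  have uc: "u @ [b] \<notin> T" for b using u assms(1) by (auto simp: binary_tree_def)
  have "(v \<notin> insert u T \<and> (v = [] \<or> butlast v \<in> insert u T)) = (v = u @ [False] \<or> v = u @ [True] \<or> v \<noteq> u \<and> v \<notin> T \<and> (v = [] \<or> butlast v \<in> T))" for v
  proof (cases v rule: rev_cases)
    case (snoc w b)
    then show ?thesis using u uc by (cases b) auto
  qed auto
  then show ?thesis by (auto simp: external_nodes_def)
qed

lemma card_external_nodes_bst:
  "finite (external_nodes (dom (bst_of_keys x n))) \<and> card (external_nodes (dom (bst_of_keys x n))) = Suc n"
proof (induction n)
  case 0
  have "external_nodes {} = {[]}" by (auto simp: external_nodes_def)
  then show ?case by simp
next
  case (Suc n)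
  let ?T = "dom (bst_of_keys x n)" and ?u = "bst_new_node (bst_of_keys x n) (x (Suc n))"
  have u: "?u \<in> external_nodes ?T" by (rule bst_new_node_external[OF finite_dom_bst])
  have "?u @ [b] \<notin> external_nodes ?T" for b
    using u by (auto simp: external_nodes_def)
  then show ?case using Suc u
    by (simp add: dom_bst_insert external_nodes_insert[OF binary_tree_bst u])
qed

lemma ran_bst: "ran (bst_of_keys x n) = x ` {1..n}"
proof (induction n)
  case (Suc n)
  have "bst_new_node (bst_of_keys x n) (x (Suc n)) \<notin> dom (bst_of_keys x n)"
    by (rule bst_new_node_notin[OF finite_dom_bst])
  then have "ran (bst_of_keys x (Suc n)) = insert (x (Suc n)) (ran (bst_of_keys x n))"
    by (simp add: bst_insert_def domIff)
  then show ?case using Suc by (simp add: atLeastAtMostSuc_conv)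
qed simp

lemma bst_of_keys_cong:
  "(\<And>i. i \<in> {1..n} \<Longrightarrow> x i = y i) \<Longrightarrow> bst_of_keys x n = bst_of_keys y n"
  by (induction n) auto

text \<open>The shape of the tree depends only on the relative order of the keys. To see this, the labels
  are replaced by the indices of the keys: a tree \<open>I\<close> of indices carries the labels
  \<open>map_option x \<circ> I\<close>.\<close>

lemma bst_path_relabel:
  assumes "\<And>u i. I u = Some i \<Longrightarrow> x i < a \<longleftrightarrow> y i < b"
  assumes "\<And>i. i < k \<Longrightarrow> bst_path (map_option x \<circ> I) a i \<in> dom I"
  shows "bst_path (map_option x \<circ> I) a k = bst_path (map_option y \<circ> I) b k"
  using assms(2)
proof (induction k)
  case (Suc k)
  have "bst_path (map_option x \<circ> I) a k \<in> dom I" using Suc(2)[of k] by (simp only: lessI)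
  then obtain i where i: "I (bst_path (map_option x \<circ> I) a k) = Some i" unfolding domIff by blast
  have eq: "bst_path (map_option x \<circ> I) a k = bst_path (map_option y \<circ> I) b k"
    by (rule Suc.IH) (rule Suc.prems, simp)
  have "the ((map_option x \<circ> I) w) = x i" "the ((map_option y \<circ> I) w) = y i" if "I w = Some i" for w
    using that by simp_all
  note this[OF i[unfolded eq]]
  then show ?case using assms(1)[OF i] unfolding bst_path.simps eq by (simp only:)
qed simp

lemma bst_new_node_relabel:
  assumes "finite (dom I)" "\<And>u i. I u = Some i \<Longrightarrow> x i < a \<longleftrightarrow> y i < b"
  shows "bst_new_node (map_option x \<circ> I) a = bst_new_node (map_option y \<circ> I) b"
proof -
  let ?A = "map_option x \<circ> I" and ?B = "map_option y \<circ> I"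
  have d: "dom ?A = dom I" "dom ?B = dom I" by (auto simp: dom_def)
  have fin: "finite (dom ?A)" using d assms by simp
  define m where "m = (LEAST k. bst_path ?A a k \<notin> dom ?A)"
  have m: "bst_path ?A a m \<notin> dom ?A" unfolding m_def by (rule LeastI_ex[OF bst_path_leaves[OF fin]])
  have less: "bst_path ?A a j \<in> dom I" if "j < m" for j
    using not_less_Least that d unfolding m_def by blast
  have eq: "bst_path ?A a k = bst_path ?B b k" if "k \<le> m" for k
    by (rule bst_path_relabel) (use that less assms in auto)
  have "(LEAST k. bst_path ?B b k \<notin> dom ?B) = m"
  proof (rule Least_equality)
    show "bst_path ?B b m \<notin> dom ?B" using m eq[of m] d by simp
    show "m \<le> k" if "bst_path ?B b k \<notin> dom ?B" for k
      using that less[of k] eq[of k] d by (cases "k < m") auto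
  qed
  then show ?thesis unfolding bst_new_node_def m_def[symmetric] using eq[of m] by simp
qed

lemma bst_of_keys_order_iso_aux:
  assumes "\<And>i j. i \<in> {1..n} \<Longrightarrow> j \<in> {1..n} \<Longrightarrow> x i < x j \<longleftrightarrow> y i < y j"
  shows "\<exists>I. bst_of_keys x n = map_option x \<circ> I \<and> bst_of_keys y n = map_option y \<circ> I \<and> ran I \<subseteq> {1..n}"
  using assms
proof (induction n)
  case 0
  show ?case by (rule exI[of _ Map.empty]) auto
next
  case (Suc n)
  have "\<exists>I. bst_of_keys x n = map_option x \<circ> I \<and> bst_of_keys y n = map_option y \<circ> I \<and> ran I \<subseteq> {1..n}"
    by (rule Suc.IH) (use Suc.prems in auto)
  then obtain I where I: "bst_of_keys x n = map_option x \<circ> I" "bst_of_keys y n = map_option y \<circ> I" "ran I \<subseteq> {1..n}"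
    by blast
  let ?u = "bst_new_node (map_option x \<circ> I) (x (Suc n))"
  have fin: "finite (dom I)" using finite_dom_bst[of x n] unfolding I(1) by (simp add: dom_def)
  have eq: "?u = bst_new_node (map_option y \<circ> I) (y (Suc n))"
  proof (rule bst_new_node_relabel[OF fin])
    show "x i < x (Suc n) \<longleftrightarrow> y i < y (Suc n)" if "I u = Some i" for u i
    proof -
      have "i \<in> {1..n}" using that I(3) by (auto simp: ran_def)
      then show ?thesis using Suc.prems[of i "Suc n"] by auto
    qed
  qed
  have "ran (I(?u \<mapsto> Suc n)) \<subseteq> {1..Suc n}"
    using I(3) unfolding ran_def by (auto split: if_splits)
  moreover have "bst_of_keys x (Suc n) = map_option x \<circ> I(?u \<mapsto> Suc n)"
    by (auto simp: I bst_insert_def fun_eq_iff)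
  moreover have "bst_of_keys y (Suc n) = map_option y \<circ> I(?u \<mapsto> Suc n)"
    by (auto simp: I bst_insert_def eq fun_eq_iff)
  ultimately show ?case by blast
qed

lemma dom_bst_order_iso:
  assumes "\<And>i j. i \<in> {1..n} \<Longrightarrow> j \<in> {1..n} \<Longrightarrow> x i < x j \<longleftrightarrow> y i < y j"
  shows "dom (bst_of_keys x n) = dom (bst_of_keys y n)"
proof -
  obtain I where "bst_of_keys x n = map_option x \<circ> I" "bst_of_keys y n = map_option y \<circ> I"
    using bst_of_keys_order_iso_aux[of n x y] assms by blast
  then show ?thesis by (auto simp: dom_def)
qed

section \<open>Trees of permutations\<close>

text \<open>A permutation of the indices is given by the list of the indices in increasing order of their
  keys. The position in this list serves as a canonical choice of keys; for indices that do not occur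
  in the list its value is arbitrary.\<close>

definition position :: "nat list \<Rightarrow> nat \<Rightarrow> real" where
  "position xs i = real (LEAST k. k < length xs \<and> xs ! k = i)"

definition perm_tree :: "nat list \<Rightarrow> node set" where
  "perm_tree xs = dom (bst_of_keys (position xs) (length xs))"

lemma position_nth: "distinct xs \<Longrightarrow> k < length xs \<Longrightarrow> position xs (xs ! k) = real k"
  unfolding position_def by (rule arg_cong[of _ _ real], rule Least_equality) (auto simp: nth_eq_iff_index_eq)

lemma perm_tree_eq:
  assumes xs: "xs \<in> permutations_of_set {1..n}" and x: "sorted_wrt (\<lambda>i j. x i < x j) xs"
  shows "dom (bst_of_keys x n) = perm_tree xs"
proof -
  have d: "distinct xs" "set xs = {1..n}" using xs by (auto simp: permutations_of_set_def)
  have len: "length xs = n" using d distinct_card by fastforce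
  show ?thesis unfolding perm_tree_def len
  proof (rule dom_bst_order_iso)
    fix i j assume "i \<in> {1..n}" "j \<in> {1..n}"
    then obtain a b where a: "a < length xs" "xs ! a = i" and b: "b < length xs" "xs ! b = j"
      using d(2) by (metis in_set_conv_nth)
    have mono: "x (xs ! k) < x (xs ! l)" if "k < l" "l < length xs" for k l
      using x that by (simp add: sorted_wrt_iff_nth_less)
    have "x i < x j \<longleftrightarrow> a < b"
      using mono[of a b] mono[of b a] a b by (cases a b rule: linorder_cases) auto
    then show "x i < x j \<longleftrightarrow> position xs i < position xs j"
      using position_nth[OF d(1)] a b by auto
  qed
qed

text \<open>Here \<open>j\<close> is the number of elements in front of the inserted one.\<close>

definition insert_at :: "nat \<Rightarrow> 'b \<Rightarrow> 'b list \<Rightarrow> 'b list" where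
  "insert_at j a xs = take j xs @ a # drop j xs"

lemma bij_betw_insert_at:
  "bij_betw (\<lambda>(xs, j). insert_at j (Suc n) xs) (permutations_of_set {1..n} \<times> {0..n})
     (permutations_of_set {1..Suc n})"
proof -
  let ?f = "\<lambda>(xs, j). insert_at j (Suc n) xs"
  let ?A = "permutations_of_set {1..n} \<times> {0..n}" and ?B = "permutations_of_set {1..Suc n}"
  have len: "length xs = n" if "xs \<in> permutations_of_set {1..n}" for xs :: "nat list"
    using that by (simp add: length_finite_permutations_of_set)
  have inj: "inj_on ?f ?A"
  proof (rule inj_onI, clarify)
    fix xs j xs' j' assume a: "xs \<in> permutations_of_set {1..n}" "xs' \<in> permutations_of_set {1..n}"
      "j \<in> {0..n}" "j' \<in> {0..n}" and eq: "insert_at j (Suc n) xs = insert_at j' (Suc n) xs'"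
    have ni: "Suc n \<notin> set xs" "Suc n \<notin> set xs'" using a by (auto simp: permutations_of_set_def)
    have "take j xs = take j' xs' \<and> drop j xs = drop j' xs'"
      using eq ni unfolding insert_at_def
      by (metis (no_types, lifting) append_Cons_eq_iff in_set_takeD in_set_dropD)
    then have "xs = xs'" "length (take j xs) = length (take j' xs')" by (metis append_take_drop_id, simp)
    then show "xs = xs' \<and> j = j'" using len a by auto
  qed
  have sub: "?f ` ?A \<subseteq> ?B"
  proof (clarify)
    fix xs j assume a: "xs \<in> permutations_of_set {1..n}" "j \<in> {0..n}"
    have d: "distinct xs" "set xs = {1..n}" using a by (auto simp: permutations_of_set_def)
    have "distinct (take j xs @ drop j xs)" "set (take j xs @ drop j xs) = {1..n}"
      by (simp_all only: append_take_drop_id d)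
    then have "distinct (insert_at j (Suc n) xs)" "set (insert_at j (Suc n) xs) = insert (Suc n) {1..n}"
      unfolding insert_at_def distinct_append set_append list.set distinct.simps
      using set_take_subset[of j xs] set_drop_subset[of j xs] d(2) by auto
    then show "insert_at j (Suc n) xs \<in> permutations_of_set {1..Suc n}"
      by (intro permutations_of_setI) (auto simp: atLeastAtMostSuc_conv)
  qed
  have "card (?f ` ?A) = card ?A" by (rule card_image[OF inj])
  also have "\<dots> = card ?B" by (simp add: card_cartesian_product)
  finally have "?f ` ?A = ?B" using sub by (intro card_subset_eq) auto
  then show ?thesis using inj by (simp add: bij_betw_def)
qed

text \<open>The rank \<open>j\<close> of a new key is realised by the key \<open>j - 1/2\<close>, which lies between the positions
  \<open>j - 1\<close> and \<open>j\<close>. Different ranks lead to different external nodes, and all \<open>n + 1\<close> external nodes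
  arise, since there are just as many ranks.\<close>

lemma perm_tree_insert_at:
  assumes xs: "xs \<in> permutations_of_set {1..n}"
  shows "bij_betw (\<lambda>j. bst_new_node (bst_of_keys (position xs) n) (real j - 1/2)) {0..n} (external_nodes (perm_tree xs))"
    and "j \<le> n \<Longrightarrow> perm_tree (insert_at j (Suc n) xs) =
      insert (bst_new_node (bst_of_keys (position xs) n) (real j - 1/2)) (perm_tree xs)"
proof -
  let ?L = "bst_of_keys (position xs) n"
  let ?e = "\<lambda>j. bst_new_node ?L (real j - 1/2)"
  have d: "distinct xs" "set xs = {1..n}" using xs by (auto simp: permutations_of_set_def)
  have len: "length xs = n" using d distinct_card by fastforce
  have t: "perm_tree xs = dom ?L" by (simp add: perm_tree_def len)
  have ne: "?e j \<noteq> ?e k" if "j < k" "k \<le> n" for j k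
  proof
    assume "?e j = ?e k"
    then have sc: "same_cut (ran ?L) (real j - 1/2) (real k - 1/2)"
      by (rule bst_new_node_eq_imp_same_cut[OF finite_dom_bst search_tree_bst])
    have "xs ! j \<in> {1..n}" using d(2) len that by (metis nth_mem order.strict_trans2)
    then have "position xs (xs ! j) \<in> ran ?L" unfolding ran_bst by blast
    then have "real j \<in> ran ?L" using position_nth[OF d(1)] len that by simp
    then show False using sc that unfolding same_cut_def by fastforce
  qed
  have inj: "inj_on ?e {0..n}"
    by (rule linorder_inj_onI') (use ne in auto)
  have "?e ` {0..n} \<subseteq> external_nodes (dom ?L)"
    using bst_new_node_external[OF finite_dom_bst] by auto
  then have "?e ` {0..n} = external_nodes (dom ?L)"
    using card_external_nodes_bst[of "position xs" n] card_image[OF inj]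
    by (intro card_subset_eq) auto
  then show "bij_betw ?e {0..n} (external_nodes (perm_tree xs))" using inj t by (simp add: bij_betw_def)
  assume j: "j \<le> n"
  define z where "z = (position xs)(Suc n := real j - 1/2)"
  let ?ys = "insert_at j (Suc n) xs"
  have ys: "?ys \<in> permutations_of_set {1..Suc n}"
    using bij_betwE[OF bij_betw_insert_at[of n]] xs j by auto
  have zk: "z (xs ! k) = real k" if "k < n" for k
    using position_nth[OF d(1)] that len d(2) nth_mem[of k xs] by (auto simp: z_def)
  have "sorted_wrt (\<lambda>i j. z i < z j) ?ys"
    unfolding insert_at_def sorted_wrt_append
  proof (intro conjI)
    show "sorted_wrt (\<lambda>i j. z i < z j) (take j xs)"
      by (auto simp: sorted_wrt_iff_nth_less len zk)
    show "sorted_wrt (\<lambda>i j. z i < z j) (Suc n # drop j xs)"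
      unfolding sorted_wrt.simps
    proof (intro conjI)
      show "sorted_wrt (\<lambda>i j. z i < z j) (drop j xs)"
        by (auto simp: sorted_wrt_iff_nth_less len zk)
    qed (auto simp: len zk in_set_conv_nth z_def[THEN fun_cong, of "Suc n"])
    show "\<forall>x\<in>set (take j xs). \<forall>y\<in>set (Suc n # drop j xs). z x < z y"
      by (auto simp: len zk in_set_conv_nth z_def[THEN fun_cong, of "Suc n"])
  qed
  then have "perm_tree ?ys = dom (bst_of_keys z (Suc n))" using perm_tree_eq[OF ys] by simp
  also have "bst_of_keys z n = ?L" by (rule bst_of_keys_cong) (auto simp: z_def)
  then have "dom (bst_of_keys z (Suc n)) = insert (?e j) (dom ?L)"
    by (simp add: dom_bst_insert) (simp add: z_def)
  finally show "perm_tree ?ys = insert (?e j) (perm_tree xs)" using t by simp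
qed

lemma sum_perm_tree_Suc:
  fixes g :: "node set \<Rightarrow> real"
  shows "(\<Sum>ys\<in>permutations_of_set {1..Suc n}. g (perm_tree ys)) =
    (\<Sum>xs\<in>permutations_of_set {1..n}. \<Sum>u\<in>external_nodes (perm_tree xs). g (insert u (perm_tree xs)))"
proof -
  have "(\<Sum>ys\<in>permutations_of_set {1..Suc n}. g (perm_tree ys)) =
     (\<Sum>(xs, j)\<in>permutations_of_set {1..n} \<times> {0..n}. g (perm_tree (insert_at j (Suc n) xs)))"
    using sum.reindex_bij_betw[OF bij_betw_insert_at, of "\<lambda>ys. g (perm_tree ys)" n]
    by (simp add: case_prod_beta)
  also have "\<dots> = (\<Sum>xs\<in>permutations_of_set {1..n}. \<Sum>j\<in>{0..n}. g (perm_tree (insert_at j (Suc n) xs)))"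
    by (simp add: sum.cartesian_product)
  also have "\<dots> = (\<Sum>xs\<in>permutations_of_set {1..n}. \<Sum>u\<in>external_nodes (perm_tree xs). g (insert u (perm_tree xs)))"
  proof (rule sum.cong[OF refl])
    fix xs :: "nat list" assume xs: "xs \<in> permutations_of_set {1..n}"
    show "(\<Sum>j\<in>{0..n}. g (perm_tree (insert_at j (Suc n) xs))) = (\<Sum>u\<in>external_nodes (perm_tree xs). g (insert u (perm_tree xs)))"
      unfolding sum.reindex_bij_betw[OF perm_tree_insert_at(1)[OF xs], symmetric]
      by (rule sum.cong[OF refl]) (simp add: perm_tree_insert_at(2)[OF xs])
  qed
  finally show ?thesis .
qed

section \<open>The tree process of independent uniform keys\<close>

text \<open>The keys are \<open>X 1, X 2, \<dots>\<close>; nothing is assumed about \<open>X 0\<close>.\<close>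

locale iid_keys = prob_space M for M :: "'a measure" +
  fixes X :: "nat \<Rightarrow> 'a \<Rightarrow> real"
  assumes indep: "indep_vars (\<lambda>_. borel) X {1..}"
    and uniform: "n \<ge> 1 \<Longrightarrow> distr M lborel (X n) = uniform_measure lborel {0..1}"
begin

abbreviation "tree n \<omega> \<equiv> dom (bst_of_keys (\<lambda>i. X i \<omega>) n)"

abbreviation "U \<equiv> uniform_measure lborel {0..1::real}"

lemma measurable_key [measurable]: "n \<ge> 1 \<Longrightarrow> X n \<in> borel_measurable M"
  using indep by (auto simp: indep_vars_def)

lemma distr_key: "n \<ge> 1 \<Longrightarrow> distr M borel (X n) = U"
  using uniform[of n] by (simp add: distr_cong[of M M borel lborel])

lemma prob_space_U: "prob_space U"
  by (rule prob_space_uniform_measure) auto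

lemma distr_keys:
  assumes "finite I" "I \<noteq> {}" "inj_on f I" "f ` I \<subseteq> {1..}"
  shows "distr M (\<Pi>\<^sub>M i\<in>I. borel) (\<lambda>\<omega>. \<lambda>i\<in>I. X (f i) \<omega>) = (\<Pi>\<^sub>M i\<in>I. U)"
proof -
  let ?K = "f ` I"
  have iv: "indep_vars (\<lambda>_. borel) X ?K" using indep_vars_subset[OF indep assms(4)] .
  have 1: "distr M (\<Pi>\<^sub>M i\<in>?K. borel) (\<lambda>\<omega>. \<lambda>i\<in>?K. X i \<omega>) = (\<Pi>\<^sub>M i\<in>?K. distr M borel (X i))"
    using iv assms by (subst (asm) indep_vars_iff_distr_eq_PiM') auto
  also have "\<dots> = (\<Pi>\<^sub>M i\<in>?K. U)" using assms(4) by (intro PiM_cong) (auto simp: distr_key)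
  finally have 2: "distr M (\<Pi>\<^sub>M i\<in>?K. borel) (\<lambda>\<omega>. \<lambda>i\<in>?K. X i \<omega>) = (\<Pi>\<^sub>M i\<in>?K. U)" .
  have s: "sets (\<Pi>\<^sub>M i\<in>J. U) = sets (\<Pi>\<^sub>M i\<in>J. borel)" for J :: "'b set"
    by (intro sets_PiM_cong) auto
  have "(\<Pi>\<^sub>M i\<in>I. U) = distr (\<Pi>\<^sub>M i\<in>?K. U) (\<Pi>\<^sub>M i\<in>I. U) (\<lambda>\<omega>. \<lambda>n\<in>I. \<omega> (f n))"
    by (rule distr_PiM_reindex[symmetric]) (use assms prob_space_U in auto)
  also have "\<dots> = distr (\<Pi>\<^sub>M i\<in>?K. U) (\<Pi>\<^sub>M i\<in>I. borel) (\<lambda>\<omega>. \<lambda>n\<in>I. \<omega> (f n))"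
    by (rule distr_cong) (auto simp: s)
  also have "\<dots> = distr (distr M (\<Pi>\<^sub>M i\<in>?K. borel) (\<lambda>\<omega>. \<lambda>i\<in>?K. X i \<omega>)) (\<Pi>\<^sub>M i\<in>I. borel) (\<lambda>\<omega>. \<lambda>n\<in>I. \<omega> (f n))"
    unfolding 2 ..
  also have "\<dots> = distr M (\<Pi>\<^sub>M i\<in>I. borel) ((\<lambda>\<omega>. \<lambda>n\<in>I. \<omega> (f n)) \<circ> (\<lambda>\<omega>. \<lambda>i\<in>?K. X i \<omega>))"
    by (rule distr_distr) (use assms in \<open>auto intro!: measurable_restrict\<close>)
  also have "(\<lambda>\<omega>. \<lambda>n\<in>I. \<omega> (f n)) \<circ> (\<lambda>\<omega>. \<lambda>i\<in>?K. X i \<omega>) = (\<lambda>\<omega>. \<lambda>i\<in>I. X (f i) \<omega>)"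
    by (auto simp: fun_eq_iff)
  finally show ?thesis ..
qed

text \<open>The event that \<open>xs\<close> lists its indices in increasing order of their keys. By exchangeability,
  if the indices are distinct and positive, its probability depends only on their number.\<close>

definition sorted_event :: "nat list \<Rightarrow> 'a set" where
  "sorted_event xs = {\<omega> \<in> space M. sorted_wrt (\<lambda>i j. X i \<omega> < X j \<omega>) xs}"

lemma sorted_event_altdef:
  "sorted_event xs = {\<omega> \<in> space M. \<forall>j\<in>{..<length xs}. \<forall>i\<in>{..<j}. X (xs ! i) \<omega> < X (xs ! j) \<omega>}"
  by (auto simp: sorted_event_def sorted_wrt_iff_nth_less)

lemma sorted_event_meas:
  assumes "set xs \<subseteq> {1..}"
  shows "sorted_event xs \<in> sets M"
  unfolding sorted_event_altdef
proof (intro sets.sets_Collect_finite_All)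
  fix j i assume "j \<in> {..<length xs}" "i \<in> {..<j}"
  then have "xs ! i \<in> set xs" "xs ! j \<in> set xs" by auto
  then have "X (xs ! i) \<in> borel_measurable M" "X (xs ! j) \<in> borel_measurable M" using assms by auto
  then show "{\<omega> \<in> space M. X (xs ! i) \<omega> < X (xs ! j) \<omega>} \<in> sets M" by measurable
qed auto

lemma prob_sorted_event:
  assumes xs: "distinct xs" "set xs \<subseteq> {1..}" "xs \<noteq> []" and n: "length xs = n"
  shows "prob (sorted_event xs) = measure (\<Pi>\<^sub>M i\<in>{..<n}. U) {f \<in> space (\<Pi>\<^sub>M i\<in>{..<n}. borel). \<forall>j\<in>{..<n}. \<forall>i\<in>{..<j}. f i < f j}"
proof -
  let ?P = "\<Pi>\<^sub>M i\<in>{..<n}. (borel :: real measure)"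
  let ?A = "{f \<in> space ?P. \<forall>j\<in>{..<n}. \<forall>i\<in>{..<j}. f i < f j}"
  let ?F = "\<lambda>\<omega>. \<lambda>i\<in>{..<n}. X (xs ! i) \<omega>"
  have nth: "xs ! i \<in> {1..}" if "i < n" for i using xs(2) n that nth_mem by blast
  have "distr M ?P ?F = (\<Pi>\<^sub>M i\<in>{..<n}. U)"
    by (rule distr_keys) (use xs n nth in \<open>auto simp: inj_on_def nth_eq_iff_index_eq\<close>)
  moreover have "?A \<in> sets ?P"
  proof (intro sets.sets_Collect_finite_All)
    fix j i assume "j \<in> {..<n}" "i \<in> {..<j}"
    then have "(\<lambda>f. f i) \<in> borel_measurable ?P" "(\<lambda>f. f j) \<in> borel_measurable ?P" by auto
    then show "{f \<in> space ?P. f i < f j} \<in> sets ?P" by measurable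
  qed auto
  moreover have "?F \<in> M \<rightarrow>\<^sub>M ?P"
    by (intro measurable_restrict) (use nth in auto)
  ultimately have "measure (\<Pi>\<^sub>M i\<in>{..<n}. U) ?A = prob (?F -` ?A \<inter> space M)"
    using measure_distr[of ?F M ?P ?A] by (simp only:)
  also have "?F -` ?A \<inter> space M = sorted_event xs"
    by (auto simp: sorted_event_altdef n space_PiM)
  finally show ?thesis ..
qed

lemma AE_no_ties:
  assumes "i \<ge> 1" "j \<ge> 1" "i \<noteq> j"
  shows "AE \<omega> in M. X i \<omega> \<noteq> X j \<omega>"
proof -
  interpret U: prob_space U by (rule prob_space_U)
  interpret P: pair_prob_space U U ..
  let ?f = "case_bool i j"
  have "distr M (\<Pi>\<^sub>M b\<in>UNIV. borel) (\<lambda>\<omega>. \<lambda>b\<in>UNIV. X (?f b) \<omega>) = (\<Pi>\<^sub>M b\<in>(UNIV :: bool set). U)"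
    by (rule distr_keys) (use assms in \<open>auto simp: inj_on_def split: bool.splits\<close>)
  also have "\<dots> = (\<Pi>\<^sub>M b\<in>UNIV. distr M borel (X (?f b)))"
    by (rule PiM_cong) (use assms in \<open>auto simp: distr_key split: bool.splits\<close>)
  finally have "indep_vars (\<lambda>_. borel) (\<lambda>b. X (?f b)) UNIV"
    by (subst indep_vars_iff_distr_eq_PiM') (use assms in \<open>auto split: bool.splits\<close>)
  moreover have "case_bool borel borel = (\<lambda>_. borel :: real measure)" "case_bool (X i) (X j) = (\<lambda>b. X (?f b))"
    by (auto simp: fun_eq_iff split: bool.splits)
  ultimately have "indep_var borel (X i) borel (X j)" unfolding indep_var_def by simp
  then have d: "distr M (borel \<Otimes>\<^sub>M borel) (\<lambda>\<omega>. (X i \<omega>, X j \<omega>)) = U \<Otimes>\<^sub>M U"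
    using assms unfolding indep_var_distribution_eq by (simp add: distr_key)
  have "AE x in U. AE y in U. x \<noteq> y"
  proof (rule AE_I2)
    fix x :: real
    have "AE y in lborel. x \<noteq> y" using AE_lborel_singleton[of x] by eventually_elim auto
    then show "AE y in U. x \<noteq> y" by (intro AE_uniform_measureI) auto
  qed
  then have "AE p in U \<Otimes>\<^sub>M U. fst p \<noteq> snd p"
  proof (intro P.AE_pair_measure)
    have "sets (U \<Otimes>\<^sub>M U) = sets (borel \<Otimes>\<^sub>M borel)" by (intro sets_pair_measure_cong) auto
    moreover have "{p \<in> space (borel \<Otimes>\<^sub>M borel). fst p \<noteq> (snd p :: real)} \<in> sets (borel \<Otimes>\<^sub>M borel)"
      by measurable
    ultimately show "{p \<in> space (U \<Otimes>\<^sub>M U). fst p \<noteq> snd p} \<in> sets (U \<Otimes>\<^sub>M U)"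
      by (simp add: space_pair_measure)
  qed auto
  then have "AE p in distr M (borel \<Otimes>\<^sub>M borel) (\<lambda>\<omega>. (X i \<omega>, X j \<omega>)). fst p \<noteq> snd p"
    unfolding d .
  then show ?thesis
    using assms by (subst (asm) AE_distr_iff) auto
qed


text \<open>All comparisons between the first \<open>n\<close> keys. They determine the tree, and they take finitely many
  values; this makes the tree measurable for the discrete sigma-algebra on sets of nodes.\<close>

definition comparisons :: "nat \<Rightarrow> (nat \<Rightarrow> real) \<Rightarrow> (nat \<times> nat) set" where
  "comparisons n x = {p \<in> {1..n} \<times> {1..n}. x (fst p) < x (snd p)}"

lemma comparisons_eq_iff:
  assumes "r \<subseteq> {1..n} \<times> {1..n}"
  shows "comparisons n x = r \<longleftrightarrow> (\<forall>p\<in>{1..n} \<times> {1..n}. x (fst p) < x (snd p) \<longleftrightarrow> p \<in> r)"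
  using assms unfolding comparisons_def by blast

lemma tree_factor:
  obtains F where "\<And>\<omega>. tree n \<omega> = F (comparisons n (\<lambda>i. X i \<omega>))"
proof -
  define y where "y r = (SOME y. comparisons n y = r)" for r
  have "tree n \<omega> = dom (bst_of_keys (y (comparisons n (\<lambda>i. X i \<omega>))) n)" for \<omega>
  proof (rule dom_bst_order_iso)
    let ?r = "comparisons n (\<lambda>i. X i \<omega>)"
    have eq: "comparisons n (y ?r) = ?r"
      unfolding y_def by (rule someI[of "\<lambda>y. comparisons n y = ?r"]) (rule refl)
    fix i j assume "i \<in> {1..n}" "j \<in> {1..n}"
    then have "x i < x j \<longleftrightarrow> (i, j) \<in> comparisons n x" for x by (simp add: comparisons_def)
    then show "X i \<omega> < X j \<omega> \<longleftrightarrow> y ?r i < y ?r j" using eq by simp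
  qed
  then show ?thesis by (rule that)
qed

lemma comparisons_measurable:
  "(\<lambda>\<omega>. comparisons n (\<lambda>i. X i \<omega>)) \<in> M \<rightarrow>\<^sub>M count_space (Pow ({1..n} \<times> {1..n}))"
proof (subst measurable_count_space_eq2)
  let ?S = "{1..n} \<times> {1..n}"
  show "finite (Pow ?S)" by auto
  have "(\<lambda>\<omega>. comparisons n (\<lambda>i. X i \<omega>)) -` {r} \<inter> space M \<in> sets M" if r: "r \<in> Pow ?S" for r
  proof -
    have "(\<lambda>\<omega>. comparisons n (\<lambda>i. X i \<omega>)) -` {r} \<inter> space M =
        {\<omega> \<in> space M. \<forall>p\<in>?S. X (fst p) \<omega> < X (snd p) \<omega> \<longleftrightarrow> p \<in> r}"
      using comparisons_eq_iff[of r n "\<lambda>i. X i _"] r by blast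
    also have "\<dots> \<in> sets M"
    proof (intro sets.sets_Collect_finite_All)
      fix p assume "p \<in> ?S"
      then have [measurable]: "X (fst p) \<in> borel_measurable M" "X (snd p) \<in> borel_measurable M" by auto
      show "{\<omega> \<in> space M. X (fst p) \<omega> < X (snd p) \<omega> \<longleftrightarrow> p \<in> r} \<in> sets M" by measurable
    qed auto
    finally show ?thesis .
  qed
  then show "(\<lambda>\<omega>. comparisons n (\<lambda>i. X i \<omega>)) \<in> space M \<rightarrow> Pow ?S \<and>
      (\<forall>r\<in>Pow ?S. (\<lambda>\<omega>. comparisons n (\<lambda>i. X i \<omega>)) -` {r} \<inter> space M \<in> sets M)"
    by (auto simp: comparisons_def)
qed

lemma tree_measurable [measurable]: "tree n \<in> M \<rightarrow>\<^sub>M count_space UNIV"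
proof -
  obtain F where F: "\<And>\<omega>. tree n \<omega> = F (comparisons n (\<lambda>i. X i \<omega>))" using tree_factor[of n] by blast
  have "F \<circ> (\<lambda>\<omega>. comparisons n (\<lambda>i. X i \<omega>)) \<in> M \<rightarrow>\<^sub>M count_space UNIV"
    by (rule measurable_comp[OF comparisons_measurable]) auto
  then show ?thesis by (simp add: F comp_def)
qed

lemma finite_range_tree: "finite (range (tree n))"
proof -
  obtain F where F: "\<And>\<omega>. tree n \<omega> = F (comparisons n (\<lambda>i. X i \<omega>))" using tree_factor[of n] by blast
  have "range (tree n) \<subseteq> F ` Pow ({1..n} \<times> {1..n})" by (auto simp: F comparisons_def)
  then show ?thesis by (rule finite_subset) auto
qed

lemma integrable_tree:
  fixes g :: "node set \<Rightarrow> real"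
  shows "integrable M (\<lambda>\<omega>. g (tree n \<omega>))"
proof (rule integrable_const_bound)
  have "finite ((\<lambda>t. \<bar>g t\<bar>) ` range (tree n))" using finite_range_tree by blast
  then show "AE \<omega> in M. norm (g (tree n \<omega>)) \<le> Max ((\<lambda>t. \<bar>g t\<bar>) ` range (tree n))"
    by (intro AE_I2) (auto intro!: Max_ge)
qed (rule measurable_compose[OF tree_measurable], simp)

lemma ex1_sorted_perm:
  fixes x :: "nat \<Rightarrow> real"
  assumes "inj_on x {1..n}"
  shows "\<exists>!xs. xs \<in> permutations_of_set {1..n} \<and> sorted_wrt (\<lambda>i j. x i < (x j :: real)) xs"
proof (rule ex1I, rule conjI)
  let ?xs = "sort_key x [1..<Suc n]"
  have set: "set ?xs = {1..n}" by (simp only: set_sort set_upt atLeastLessThanSuc_atLeastAtMost)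
  show "?xs \<in> permutations_of_set {1..n}" by (rule permutations_of_setI[OF set]) simp
  have "sorted (map x ?xs)" by (rule sorted_sort_key)
  moreover have "distinct (map x ?xs)" unfolding distinct_map set using assms by simp
  ultimately show "sorted_wrt (\<lambda>i j. x i < x j) ?xs"
    unfolding sorted_wrt_map[symmetric] strict_sorted_iff by simp
  then have 1: "sorted_wrt (<) (map x ?xs)" by (simp only: sorted_wrt_map)
  fix ys assume ys: "ys \<in> permutations_of_set {1..n} \<and> sorted_wrt (\<lambda>i j. x i < x j) ys"
  then have s: "set ys = {1..n}" by (simp add: permutations_of_set_def)
  from ys have 2: "sorted_wrt (<) (map x ys)" by (simp only: sorted_wrt_map)
  have "map x ys = map x ?xs" by (rule strict_sorted_equal[OF 1 2]) (simp only: set_map set s)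
  then show "ys = ?xs" by (rule map_inj_on) (use assms set s in auto)
qed

lemma AE_inj_keys: "AE \<omega> in M. inj_on (\<lambda>i. X i \<omega>) {1..n}"
proof -
  have "AE \<omega> in M. \<forall>i\<in>{1..n}. \<forall>j\<in>{1..n}. i \<noteq> j \<longrightarrow> X i \<omega> \<noteq> X j \<omega>"
    by (intro AE_finite_allI) (auto intro: AE_no_ties)
  then show ?thesis by eventually_elim (auto simp: inj_on_def)
qed

text \<open>The tree has the distribution of the tree of a uniformly random permutation.\<close>

lemma expectation_tree:
  fixes g :: "node set \<Rightarrow> real"
  shows "expectation (\<lambda>\<omega>. g (tree n \<omega>)) = (\<Sum>xs\<in>permutations_of_set {1..n}. g (perm_tree xs)) / fact n"
proof (cases "n = 0")
  case True
  then show ?thesis by (simp add: perm_tree_def prob_space)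
next
  case False
  let ?P = "permutations_of_set {1..n}"
  define c where "c = measure (\<Pi>\<^sub>M i\<in>{..<n}. U) {f \<in> space (\<Pi>\<^sub>M i\<in>{..<n}. borel). \<forall>j\<in>{..<n}. \<forall>i\<in>{..<j}. f i < f j}"
  have xs: "distinct xs" "set xs = {1..n}" "length xs = n" if "xs \<in> ?P" for xs
    using that by (auto simp: permutations_of_set_def length_finite_permutations_of_set)
  have meas: "sorted_event xs \<in> sets M" if "xs \<in> ?P" for xs
    by (rule sorted_event_meas) (use xs[OF that] in auto)
  have pc: "prob (sorted_event xs) = c" if "xs \<in> ?P" for xs
    unfolding c_def by (rule prob_sorted_event) (use xs[OF that] False in auto)
  have E: "expectation (\<lambda>\<omega>. h (tree n \<omega>)) = c * (\<Sum>xs\<in>?P. h (perm_tree xs))" for h :: "node set \<Rightarrow> real"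
  proof -
    have "expectation (\<lambda>\<omega>. h (tree n \<omega>)) = expectation (\<lambda>\<omega>. \<Sum>xs\<in>?P. h (perm_tree xs) * indicator (sorted_event xs) \<omega>)"
    proof (rule integral_cong_AE)
      show "AE \<omega> in M. h (tree n \<omega>) = (\<Sum>xs\<in>?P. h (perm_tree xs) * indicator (sorted_event xs) \<omega>)"
        using AE_inj_keys[of n] AE_space
      proof eventually_elim
        case (elim \<omega>)
        obtain zs where zs: "zs \<in> ?P" "sorted_wrt (\<lambda>i j. X i \<omega> < X j \<omega>) zs"
          and uniq: "\<And>xs. xs \<in> ?P \<Longrightarrow> sorted_wrt (\<lambda>i j. X i \<omega> < X j \<omega>) xs \<Longrightarrow> xs = zs"
          using ex1_sorted_perm[OF elim(1)] by (elim ex1E conjE) metis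
        have "(\<Sum>xs\<in>?P. h (perm_tree xs) * indicator (sorted_event xs) \<omega>) =
            (\<Sum>xs\<in>?P. if xs = zs then h (perm_tree xs) else 0)"
        proof (rule sum.cong[OF refl])
          fix xs assume "xs \<in> ?P"
          then have "\<omega> \<in> sorted_event xs \<longleftrightarrow> xs = zs"
            using uniq[of xs] zs elim(2) unfolding sorted_event_def by blast
          then show "h (perm_tree xs) * indicator (sorted_event xs) \<omega> = (if xs = zs then h (perm_tree xs) else 0)"
            by (simp add: indicator_def)
        qed
        also have "\<dots> = h (perm_tree zs)" using zs by simp
        also have "perm_tree zs = tree n \<omega>" using perm_tree_eq[OF zs] by simp
        finally show ?case ..
      qed
      show "(\<lambda>\<omega>. \<Sum>xs\<in>?P. h (perm_tree xs) * indicator (sorted_event xs) \<omega>) \<in> borel_measurable M"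
        using meas by (intro borel_measurable_sum borel_measurable_times) auto
      show "(\<lambda>\<omega>. h (tree n \<omega>)) \<in> borel_measurable M"
        by (rule borel_measurable_integrable[OF integrable_tree])
    qed
    also have "\<dots> = (\<Sum>xs\<in>?P. h (perm_tree xs) * prob (sorted_event xs))"
      using meas by (subst Bochner_Integration.integral_sum) (auto simp: Int_absorb1 sets.sets_into_space less_top[symmetric])
    also have "\<dots> = c * (\<Sum>xs\<in>?P. h (perm_tree xs))"
      by (simp add: pc sum_distrib_left mult.commute)
    finally show ?thesis .
  qed
  have "c * fact n = 1" using E[of "\<lambda>_. 1"] by (simp add: prob_space)
  then have "c = 1 / fact n" by (simp add: field_simps)
  then show ?thesis using E[of g] by simp
qed

text \<open>The Markov property: given \<open>T\<^sub>n\<close>, the next tree is \<open>T\<^sub>n\<close> together with a uniformly chosen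
  external node.\<close>

theorem expectation_tree_Suc:
  fixes g :: "node set \<Rightarrow> real"
  shows "expectation (\<lambda>\<omega>. g (tree (Suc n) \<omega>)) =
    expectation (\<lambda>\<omega>. (\<Sum>u\<in>external_nodes (tree n \<omega>). g (insert u (tree n \<omega>))) / real (Suc n))"
  unfolding expectation_tree[of g] sum_perm_tree_Suc
    expectation_tree[of "\<lambda>t. (\<Sum>u\<in>external_nodes t. g (insert u t)) / real (Suc n)"]
  by (simp add: sum_divide_distrib mult.commute)

end

section \<open>Vectors of independent Bernoulli variables\<close>

abbreviation bern_vec :: "real \<Rightarrow> ('d::finite \<Rightarrow> bool) pmf" where
  "bern_vec p \<equiv> Pi_pmf UNIV False (\<lambda>_. bernoulli_pmf p)"

lemma expectation_bern_vec:
  fixes G :: "('d::finite \<Rightarrow> bool) \<Rightarrow> real"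
  shows "measure_pmf.expectation (bern_vec p) G = (\<Sum>b\<in>UNIV. pmf (bern_vec p) b * G b)"
  by (subst integral_measure_pmf[of UNIV]) auto

lemma pmf_bern_vec:
  assumes "0 \<le> p" "p \<le> 1"
  shows "pmf (bern_vec p) (b :: 'd::finite \<Rightarrow> bool) = (\<Prod>l\<in>UNIV. if b l then p else 1 - p)"
  using assms by (subst pmf_Pi) (auto intro!: prod.cong)

lemma pmf_bern_vec_le:
  assumes p: "0 \<le> p" "p \<le> 1" and S: "\<And>l. l \<in> S \<Longrightarrow> b l"
  shows "pmf (bern_vec p) (b :: 'd::finite \<Rightarrow> bool) \<le> p ^ card S"
proof -
  have "pmf (bern_vec p) b = (\<Prod>l\<in>S. if b l then p else 1 - p) * (\<Prod>l\<in>UNIV - S. if b l then p else 1 - p)"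
    unfolding pmf_bern_vec[OF p] by (subst mult.commute, rule prod.subset_diff) auto
  also have "\<dots> \<le> (\<Prod>l\<in>S. if b l then p else 1 - p) * 1"
    by (intro mult_left_mono prod_le_1 prod_nonneg) (use p in auto)
  also have "(\<Prod>l\<in>S. if b l then p else 1 - p) = p ^ card S" using S by simp
  finally show ?thesis by simp
qed

lemma card_bool_fun: "real (card (UNIV :: ('d::finite \<Rightarrow> bool) set)) = 2 ^ CARD('d)"
  by (simp add: card_fun)

lemma bern_vec_first_order:
  fixes G :: "('d::finite \<Rightarrow> bool) \<Rightarrow> real"
  assumes p: "0 \<le> p" "p \<le> 1" and G: "\<And>b. \<bar>G b\<bar> \<le> B" and G0: "G (\<lambda>_. False) = 0"
  shows "\<bar>measure_pmf.expectation (bern_vec p) G\<bar> \<le> 2 ^ CARD('d) * p * B"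
proof -
  have B: "0 \<le> B" using G[of "\<lambda>_. False"] by simp
  have "\<bar>pmf (bern_vec p) b * G b\<bar> \<le> p * B" for b :: "'d \<Rightarrow> bool"
  proof (cases "\<exists>l. b l")
    case True
    then obtain l where "b l" by auto
    then have "pmf (bern_vec p) b \<le> p" using pmf_bern_vec_le[OF p, of "{l}" b] by simp
    then show ?thesis unfolding abs_mult using G[of b] p by (intro mult_mono) auto
  next
    case False
    then have "b = (\<lambda>_. False)" by auto
    then show ?thesis using G0 p B by simp
  qed
  then have "\<bar>measure_pmf.expectation (bern_vec p) G\<bar> \<le> (\<Sum>b\<in>(UNIV :: ('d \<Rightarrow> bool) set). p * B)"
    unfolding expectation_bern_vec by (intro order_trans[OF sum_abs] sum_mono) auto
  then show ?thesis using card_bool_fun[where 'd='d] by simp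
qed

text \<open>Up to an error of order \<open>p\<^sup>2\<close>, at most one component is true, and each of the unit vectors
  has weight \<open>p\<close>.\<close>

lemma bern_vec_second_order:
  fixes G :: "('d::finite \<Rightarrow> bool) \<Rightarrow> real"
  assumes p: "0 \<le> p" "p \<le> 1" and G: "\<And>b. \<bar>G b\<bar> \<le> B" and G0: "G (\<lambda>_. False) = 0"
  shows "\<bar>measure_pmf.expectation (bern_vec p) G - p * (\<Sum>l\<in>UNIV. G (\<lambda>i. i = l))\<bar>
    \<le> 2 ^ CARD('d) * (real CARD('d) * p\<^sup>2) * B"
proof -
  have B: "0 \<le> B" using G[of "\<lambda>_. False"] by simp
  let ?\<delta> = "\<lambda>l::'d. (\<lambda>i. i = l)"
  have inj: "inj ?\<delta>" by (auto simp: inj_def fun_eq_iff)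
  define w where "w b = (if b \<in> range ?\<delta> then p else 0)" for b :: "'d \<Rightarrow> bool"
  have "(\<Sum>b\<in>UNIV. w b * G b) = (\<Sum>b\<in>range ?\<delta>. p * G b)"
    unfolding w_def by (intro sum.mono_neutral_cong_right) auto
  also have "\<dots> = p * (\<Sum>l\<in>UNIV. G (?\<delta> l))"
    by (simp add: sum.reindex[OF inj] sum_distrib_left)
  finally have *: "p * (\<Sum>l\<in>UNIV. G (?\<delta> l)) = (\<Sum>b\<in>UNIV. w b * G b)" ..
  have d: "CARD('d) > 0" by simp
  have dp: "p\<^sup>2 \<le> real CARD('d) * p\<^sup>2" using mult_right_mono[of 1 "real CARD('d)" "p\<^sup>2"] d by simp
  have "\<bar>(pmf (bern_vec p) b - w b) * G b\<bar> \<le> real CARD('d) * p\<^sup>2 * B" for b :: "'d \<Rightarrow> bool"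
  proof -
    consider "b = (\<lambda>_. False)" | l where "b = ?\<delta> l" | k l where "k \<noteq> l" "b k" "b l" "b \<notin> range ?\<delta>"
    proof -
      assume a: "b = (\<lambda>_. False) \<Longrightarrow> thesis" "\<And>l. b = ?\<delta> l \<Longrightarrow> thesis"
        "\<And>k l. k \<noteq> l \<Longrightarrow> b k \<Longrightarrow> b l \<Longrightarrow> b \<notin> range ?\<delta> \<Longrightarrow> thesis"
      show thesis
      proof (cases "b \<in> range ?\<delta> \<or> b = (\<lambda>_. False)")
        case True
        then show ?thesis using a(1,2) by blast
      next
        case False
        then obtain l where l: "b l" by auto
        have "b \<noteq> ?\<delta> l" using False by blast
        then obtain k where "b k \<noteq> (k = l)" by (auto simp: fun_eq_iff)
        then show ?thesis using a(3)[of k l] l False by (cases "k = l") auto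
      qed
    qed
    then show ?thesis
    proof cases
      case 1
      then show ?thesis using G0 p B by simp
    next
      case 2
      have "pmf (bern_vec p) b = (\<Prod>i\<in>{l}. if b i then p else 1 - p) * (\<Prod>i\<in>UNIV - {l}. if b i then p else 1 - p)"
        unfolding pmf_bern_vec[OF p] by (subst mult.commute, rule prod.subset_diff) auto
      also have "(\<Prod>i\<in>UNIV - {l}. if b i then p else 1 - p) = (1 - p) ^ (CARD('d) - 1)"
        using 2 by (simp add: card_Diff_singleton)
      finally have e: "pmf (bern_vec p) b = p * (1 - p) ^ (CARD('d) - 1)" using 2 by simp
      have "1 + real (CARD('d) - 1) * (- p) \<le> (1 + - p) ^ (CARD('d) - 1)"
        by (rule Bernoulli_inequality) (use p in auto)
      then have "1 - (1 - p) ^ (CARD('d) - 1) \<le> real CARD('d) * p"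
        using p mult_right_mono[of "real (CARD('d) - 1)" "real CARD('d)" p] by simp
      then have "p * (1 - (1 - p) ^ (CARD('d) - 1)) \<le> p * (real CARD('d) * p)"
        using p by (intro mult_left_mono) auto
      moreover have "0 \<le> p * (1 - (1 - p) ^ (CARD('d) - 1))"
        using p by (intro mult_nonneg_nonneg) (auto intro: power_le_one)
      moreover have "w b = p" using 2 by (simp add: w_def)
      ultimately have "\<bar>pmf (bern_vec p) b - w b\<bar> \<le> real CARD('d) * p\<^sup>2"
        unfolding e by (simp add: power2_eq_square algebra_simps)
      then show ?thesis unfolding abs_mult using G[of b] by (intro mult_mono) auto
    next
      case 3
      then have "pmf (bern_vec p) b \<le> p\<^sup>2" using pmf_bern_vec_le[OF p, of "{k, l}" b] by (auto simp: power2_eq_square)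
      moreover have "w b = 0" using 3 by (simp add: w_def)
      ultimately have "\<bar>pmf (bern_vec p) b - w b\<bar> \<le> real CARD('d) * p\<^sup>2" using dp by simp
      then show ?thesis unfolding abs_mult using G[of b] by (intro mult_mono) auto
    qed
  qed
  then have "\<bar>\<Sum>b\<in>UNIV. (pmf (bern_vec p) b - w b) * G b\<bar> \<le> (\<Sum>b\<in>(UNIV :: ('d \<Rightarrow> bool) set). real CARD('d) * p\<^sup>2 * B)"
    by (intro order_trans[OF sum_abs] sum_mono) auto
  then show ?thesis unfolding * expectation_bern_vec
    using card_bool_fun[where 'd='d] by (simp add: sum_subtractf left_diff_distrib)
qed

text \<open>\<open>record_pmf k m\<close> is the distribution of a sum of independent Bernoulli variables with parameters
  \<open>1 / (m + 1), \<dots>, 1 / (m + k)\<close>, that is, of the number of records at times \<open>m + 1, \<dots>, m + k\<close> in a random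
  permutation. The recursion splits off the first summand.\<close>

primrec record_pmf :: "nat \<Rightarrow> nat \<Rightarrow> nat pmf" where
  "record_pmf 0 = (\<lambda>m. return_pmf 0)"
| "record_pmf (Suc k) = (\<lambda>m. bind_pmf (bernoulli_pmf (1 / real (Suc m))) (\<lambda>b.
     bind_pmf (record_pmf k (Suc m)) (\<lambda>z. return_pmf (of_bool b + z))))"

lemma finite_set_record_pmf: "finite (set_pmf (record_pmf k m))"
  by (induction k arbitrary: m) (auto simp: set_bind_pmf)

text \<open>A vector with independent components, each with distribution \<open>record_pmf k m\<close>.\<close>

definition record_vec :: "nat \<Rightarrow> nat \<Rightarrow> ('d::finite \<Rightarrow> nat) pmf" where
  "record_vec k m = Pi_pmf UNIV 0 (\<lambda>_. record_pmf k m)"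

lemma finite_set_record_vec: "finite (set_pmf (record_vec k m :: ('d::finite \<Rightarrow> nat) pmf))"
  unfolding record_vec_def by (subst set_Pi_pmf) (auto intro!: finite_PiE_dflt finite_set_record_pmf)

lemma record_vec_0: "record_vec 0 m = return_pmf (\<lambda>_. 0)"
  by (simp add: record_vec_def)

lemma record_vec_Suc:
  "(record_vec (Suc k) m :: ('d::finite \<Rightarrow> nat) pmf) = bind_pmf (bern_vec (1 / real (Suc m))) (\<lambda>b.
     map_pmf (\<lambda>z l. of_bool (b l) + z l) (record_vec k (Suc m)))"
proof -
  have "Pi_pmf (UNIV :: 'd set) 0 (\<lambda>x. bind_pmf (record_pmf k (Suc m)) (\<lambda>z. return_pmf (of_bool (b x) + z))) =
     bind_pmf (Pi_pmf UNIV 0 (\<lambda>_. record_pmf k (Suc m))) (\<lambda>f. return_pmf (\<lambda>l. of_bool (b l) + f l))" for b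
    by (subst Pi_pmf_bind[where d' = 0]) auto
  then show ?thesis
    unfolding record_vec_def record_pmf.simps
    by (subst Pi_pmf_bind[where d' = False]) (auto simp: map_pmf_def)
qed

lemma expectation_record_vec_Suc:
  fixes h :: "('d::finite \<Rightarrow> nat) \<Rightarrow> real"
  shows "measure_pmf.expectation (record_vec (Suc k) m) (\<lambda>z. h (\<lambda>l. D l + z l)) =
    measure_pmf.expectation (bern_vec (1 / real (Suc m)))
      (\<lambda>b. measure_pmf.expectation (record_vec k (Suc m)) (\<lambda>z. h (\<lambda>l. (D l + of_bool (b l)) + z l)))"
  unfolding record_vec_Suc expectation_bern_vec
  by (subst pmf_expectation_bind[of UNIV]) (auto simp: finite_set_record_vec add.assoc)


section \<open>The depths at which paths leave the tree\<close>

text \<open>The length of the first initial segment of \<open>u\<close> outside the tree; for the binary digits of \<open>s\<close>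
  this is the silhouette at \<open>s\<close>.\<close>

definition exit_depth :: "node set \<Rightarrow> (nat \<Rightarrow> bool) \<Rightarrow> nat" where
  "exit_depth T u = (LEAST k. map u [0..<k] \<notin> T)"

lemma exit_depth_notin:
  assumes "finite T"
  shows "map u [0..<exit_depth T u] \<notin> T"
proof -
  have "\<exists>k. map u [0..<k] \<notin> T"
  proof (rule ccontr)
    assume "\<not> ?thesis"
    then have "range (\<lambda>k. map u [0..<k]) \<subseteq> T" by auto
    moreover have "inj (\<lambda>k. map u [0..<k])" by (rule injI) (metis diff_zero length_map length_upt)
    ultimately show False using assms finite_subset finite_imageD infinite_UNIV_nat by blast
  qed
  then show ?thesis unfolding exit_depth_def by (rule LeastI_ex)
qed

lemma less_exit_depth: "k < exit_depth T u \<Longrightarrow> map u [0..<k] \<in> T"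
  unfolding exit_depth_def using not_less_Least by blast

lemma exit_depth_external:
  assumes "finite T"
  shows "map u [0..<exit_depth T u] \<in> external_nodes T"
proof (cases "exit_depth T u")
  case (Suc k)
  then have "butlast (map u [0..<exit_depth T u]) \<in> T" using less_exit_depth[of k T u] by simp
  then show ?thesis using exit_depth_notin[OF assms, of u]
    by (simp only: external_nodes_def mem_Collect_eq simp_thms)
qed (use exit_depth_notin[OF assms, of u] in \<open>simp add: external_nodes_def\<close>)

lemma exit_depth_insert:
  assumes T: "binary_tree T" and v: "v \<in> external_nodes T"
  shows "exit_depth (insert v T) u = exit_depth T u + of_bool (v = map u [0..<exit_depth T u])"
proof -
  have fin: "finite T" using T by (simp add: binary_tree_def)
  let ?k = "exit_depth T u"
  have n: "map u [0..<?k] \<notin> T" by (rule exit_depth_notin[OF fin])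
  then have n1: "map u [0..<Suc ?k] \<notin> T" using T unfolding binary_tree_def by auto
  show ?thesis unfolding exit_depth_def[of "insert v T"]
  proof (rule Least_equality)
    show "map u [0..<?k + of_bool (v = map u [0..<?k])] \<notin> insert v T"
      using n n1 by (auto dest: arg_cong[of _ _ length])
    show "?k + of_bool (v = map u [0..<?k]) \<le> j" if "map u [0..<j] \<notin> insert v T" for j
      using that less_exit_depth[of j T u] by (cases j "?k" rule: linorder_cases) auto
  qed
qed

lemma sum_external_nodes_single:
  fixes g :: "nat \<Rightarrow> real"
  assumes T: "binary_tree T" and ext: "finite (external_nodes T)" "card (external_nodes T) = Suc n"
  shows "(\<Sum>v\<in>external_nodes T. g (exit_depth (insert v T) u)) = real n * g (exit_depth T u) + g (Suc (exit_depth T u))"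
proof -
  have fin: "finite T" using T by (simp add: binary_tree_def)
  let ?e = "map u [0..<exit_depth T u]"
  have e: "?e \<in> external_nodes T" by (rule exit_depth_external[OF fin])
  have "(\<Sum>v\<in>external_nodes T. g (exit_depth (insert v T) u)) =
      g (exit_depth (insert ?e T) u) + (\<Sum>v\<in>external_nodes T - {?e}. g (exit_depth (insert v T) u))"
    by (rule sum.remove[OF ext(1) e])
  also have "(\<Sum>v\<in>external_nodes T - {?e}. g (exit_depth (insert v T) u)) = (\<Sum>v\<in>external_nodes T - {?e}. g (exit_depth T u))"
    by (rule sum.cong) (auto simp: exit_depth_insert[OF T])
  also have "\<dots> = real n * g (exit_depth T u)" using ext e by (simp add: card_Diff_singleton)
  finally show ?thesis by (simp add: exit_depth_insert[OF T e])
qed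

text \<open>One step of the true process is compared with adding independent Bernoulli variables. The
  difference is of order \<open>p\<close> in general, and of order \<open>p\<^sup>2\<close> if the paths leave the tree at distinct
  nodes.\<close>

lemma step_comparison:
  fixes g :: "('d::finite \<Rightarrow> nat) \<Rightarrow> real" and u :: "'d \<Rightarrow> nat \<Rightarrow> bool"
  assumes T: "binary_tree T" and ext: "finite (external_nodes T)" "card (external_nodes T) = Suc n"
    and g: "\<And>D. \<bar>g D\<bar> \<le> B"
  defines "D \<equiv> \<lambda>l. exit_depth T (u l)"
    and "p \<equiv> 1 / real (Suc n)"
  defines "\<Delta> \<equiv> \<bar>(\<Sum>v\<in>external_nodes T. g (\<lambda>l. exit_depth (insert v T) (u l))) / real (Suc n)
     - measure_pmf.expectation (bern_vec p) (\<lambda>b. g (\<lambda>l. D l + of_bool (b l)))\<bar>"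
  shows "\<Delta> \<le> (real CARD('d) + 2 ^ CARD('d)) * (2 * B) * p"
    and "inj (\<lambda>l. map (u l) [0..<D l]) \<Longrightarrow> \<Delta> \<le> 2 ^ CARD('d) * real CARD('d) * (2 * B) * p\<^sup>2"
proof -
  have fin: "finite T" using T by (simp add: binary_tree_def)
  have B: "0 \<le> B" using g[of "\<lambda>_. 0"] by simp
  have p: "0 \<le> p" "p \<le> 1" by (simp_all add: p_def)
  define e where "e l = map (u l) [0..<D l]" for l
  \<comment> \<open>Only the change of \<open>g\<close> matters: both steps preserve constants.\<close>
  define G where "G b = g (\<lambda>l. D l + of_bool (b l)) - g D" for b
  have GB: "\<bar>G b\<bar> \<le> 2 * B" for b
    unfolding G_def using g[of "\<lambda>l. D l + of_bool (b l)"] g[of D] by linarith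
  have G0: "G (\<lambda>_. False) = 0" by (simp add: G_def)
  have e: "range e \<subseteq> external_nodes T"
    unfolding e_def D_def using exit_depth_external[OF fin] by auto
  have ins: "g (\<lambda>l. exit_depth (insert v T) (u l)) = g D + G (\<lambda>l. v = e l)" if "v \<in> external_nodes T" for v
    unfolding G_def e_def D_def exit_depth_insert[OF T that] by simp
  have "(\<Sum>v\<in>external_nodes T. g (\<lambda>l. exit_depth (insert v T) (u l))) = (\<Sum>v\<in>external_nodes T. g D + G (\<lambda>l. v = e l))"
    by (rule sum.cong) (simp_all add: ins)
  also have "\<dots> = real (Suc n) * g D + (\<Sum>v\<in>external_nodes T. G (\<lambda>l. v = e l))"
    by (simp only: sum.distrib sum_constant ext(2))
  also have "(\<Sum>v\<in>external_nodes T. G (\<lambda>l. v = e l)) = (\<Sum>v\<in>range e. G (\<lambda>l. v = e l))"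
  proof (rule sum.mono_neutral_right[OF ext(1) e], rule ballI)
    fix v assume "v \<in> external_nodes T - range e"
    then have "(\<lambda>l. v = e l) = (\<lambda>_. False)" by auto
    then show "G (\<lambda>l. v = e l) = 0" using G0 by simp
  qed
  finally have Q: "(\<Sum>v\<in>external_nodes T. g (\<lambda>l. exit_depth (insert v T) (u l))) / real (Suc n) =
      g D + p * (\<Sum>v\<in>range e. G (\<lambda>l. v = e l))"
    by (simp add: p_def field_simps del: of_nat_Suc)
  have "measure_pmf.expectation (bern_vec p) (\<lambda>b. g (\<lambda>l. D l + of_bool (b l))) =
      measure_pmf.expectation (bern_vec p) (\<lambda>b. g D + G b)" by (simp add: G_def)
  also have "\<dots> = g D + measure_pmf.expectation (bern_vec p) G"
    by (subst Bochner_Integration.integral_add) (auto intro: integrable_measure_pmf_finite)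
  finally have \<Delta>: "\<Delta> = \<bar>p * (\<Sum>v\<in>range e. G (\<lambda>l. v = e l)) - measure_pmf.expectation (bern_vec p) G\<bar>"
    unfolding \<Delta>_def Q by simp
  have "\<bar>\<Sum>v\<in>range e. G (\<lambda>l. v = e l)\<bar> \<le> (\<Sum>v\<in>range e. 2 * B)"
    by (rule order_trans[OF sum_abs]) (intro sum_mono GB)
  also have "\<dots> \<le> real CARD('d) * (2 * B)"
    using B by (simp only: sum_constant) (intro mult_right_mono, auto intro: card_image_le)
  finally have "\<bar>p * (\<Sum>v\<in>range e. G (\<lambda>l. v = e l))\<bar> \<le> p * (real CARD('d) * (2 * B))"
    unfolding abs_mult using p by (simp add: mult_left_mono)
  moreover have "\<bar>measure_pmf.expectation (bern_vec p) G\<bar> \<le> 2 ^ CARD('d) * p * (2 * B)"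
    by (rule bern_vec_first_order[where G = G, OF p GB G0])
  ultimately have "\<Delta> \<le> p * (real CARD('d) * (2 * B)) + 2 ^ CARD('d) * p * (2 * B)"
    unfolding \<Delta> by linarith
  then show "\<Delta> \<le> (real CARD('d) + 2 ^ CARD('d)) * (2 * B) * p" by (simp add: algebra_simps)
  assume "inj (\<lambda>l. map (u l) [0..<D l])"
  then have inj: "inj e" by (simp add: e_def[abs_def])
  have "(\<Sum>v\<in>range e. G (\<lambda>l. v = e l)) = (\<Sum>l\<in>UNIV. G (\<lambda>i. i = l))"
  proof -
    have "(\<lambda>i. e l = e i) = (\<lambda>i. i = l)" for l using inj by (auto simp: inj_eq)
    then show ?thesis by (simp add: sum.reindex[OF inj])
  qed
  then have "\<Delta> = \<bar>measure_pmf.expectation (bern_vec p) G - p * (\<Sum>l\<in>UNIV. G (\<lambda>i. i = l))\<bar>"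
    unfolding \<Delta> by (simp add: abs_minus_commute)
  also have "\<dots> \<le> 2 ^ CARD('d) * (real CARD('d) * p\<^sup>2) * (2 * B)"
    by (rule bern_vec_second_order[where G = G, OF p GB G0])
  finally show "\<Delta> \<le> 2 ^ CARD('d) * real CARD('d) * (2 * B) * p\<^sup>2" by (simp add: algebra_simps)
qed

lemma summable_inverse_three_halves:
  "summable (\<lambda>i. 1 / (real (Suc i) * sqrt (real (Suc i))))"
proof -
  have "summable (\<lambda>i. real (Suc i) powr (-3/2))"
    using summable_real_powr_iff[of "-3/2"] by (subst summable_Suc_iff) simp
  also have "(\<lambda>i. real (Suc i) powr (-3/2)) = (\<lambda>i. 1 / (real (Suc i) * sqrt (real (Suc i))))"
  proof
    fix i
    have "real (Suc i) powr (-3/2) = 1 / (real (Suc i) powr (1 + 1/2))" by (simp add: powr_minus_divide[symmetric])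
    also have "real (Suc i) powr (1 + 1/2) = real (Suc i) * sqrt (real (Suc i))"
      by (subst powr_add) (simp add: powr_half_sqrt)
    finally show "real (Suc i) powr (-3/2) = 1 / (real (Suc i) * sqrt (real (Suc i)))" .
  qed
  finally show ?thesis .
qed

context iid_keys
begin

text \<open>The expectation equals \<open>\<Prod>i=1..n. (1 - 1 / (2 * i))\<close>.\<close>

lemma expectation_half_power_exit_depth:
  "expectation (\<lambda>\<omega>. (1/2) ^ exit_depth (tree n \<omega>) u) \<le> 1 / sqrt (real (Suc n))"
proof (induction n)
  case 0
  have "exit_depth {} u = 0" by (simp add: exit_depth_def)
  then show ?case by (simp add: prob_space)
next
  case (Suc n)
  let ?E = "expectation (\<lambda>\<omega>. (1/2) ^ exit_depth (tree n \<omega>) u)"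
  let ?c = "1 - 1 / (2 * real (Suc n))"
  have "expectation (\<lambda>\<omega>. (1/2) ^ exit_depth (tree (Suc n) \<omega>) u) =
     expectation (\<lambda>\<omega>. (\<Sum>v\<in>external_nodes (tree n \<omega>). (1/2) ^ exit_depth (insert v (tree n \<omega>)) u) / real (Suc n))"
    by (rule expectation_tree_Suc)
  also have "\<dots> = expectation (\<lambda>\<omega>. ?c * (1/2) ^ exit_depth (tree n \<omega>) u)"
  proof (rule Bochner_Integration.integral_cong)
    fix \<omega>
    let ?T = "tree n \<omega>"
    have "(\<Sum>v\<in>external_nodes ?T. (1/2) ^ exit_depth (insert v ?T) u) =
        real n * (1/2) ^ exit_depth ?T u + (1/2) ^ Suc (exit_depth ?T u)"
      by (rule sum_external_nodes_single[OF binary_tree_bst]) (simp_all add: card_external_nodes_bst)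
    moreover have "(real n * a + 1/2 * a) / real (Suc n) = ?c * a" for a
      by (simp add: field_simps)
    ultimately show "(\<Sum>v\<in>external_nodes ?T. (1/2) ^ exit_depth (insert v ?T) u) / real (Suc n) = ?c * (1/2) ^ exit_depth ?T u"
      by (simp only: power_Suc)
  qed simp
  also have "\<dots> = ?c * ?E" by simp
  also have "\<dots> \<le> ?c * (1 / sqrt (real (Suc n)))"
    by (rule mult_left_mono[OF Suc]) simp
  also have "\<dots> \<le> 1 / sqrt (real (Suc (Suc n)))"
  proof (rule power2_le_imp_le)
    have "?c\<^sup>2 / (real n + 1) \<le> 1 / (real n + 2)"
    proof -
      have "?c = (2 * real n + 1) / (2 * (real n + 1))" by (simp add: field_simps)
      moreover have "(a / (2 * b))\<^sup>2 / b = a\<^sup>2 / (4 * b ^ 3)" for a b :: real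
        by (simp add: power_divide power_mult_distrib power2_eq_square power3_eq_cube)
      ultimately have "?c\<^sup>2 / (real n + 1) = (2 * real n + 1)\<^sup>2 / (4 * (real n + 1) ^ 3)"
        by (simp only:)
      also have "\<dots> \<le> 1 / (real n + 2)"
        by (simp add: divide_simps) (simp add: power2_eq_square power3_eq_cube algebra_simps)
      finally show ?thesis .
    qed
    then show "(?c * (1 / sqrt (real (Suc n))))\<^sup>2 \<le> (1 / sqrt (real (Suc (Suc n))))\<^sup>2"
      by (simp add: power_mult_distrib power_divide add.commute)
  qed simp
  finally show ?case .
qed

text \<open>The expectation of \<open>h\<close> at time \<open>m + k\<close>, when the true process is followed up to time \<open>m\<close> and the
  remaining \<open>k\<close> vectors of increments are replaced by vectors with independent components.\<close>

definition interpolant :: "('d::finite \<Rightarrow> nat \<Rightarrow> bool) \<Rightarrow> (('d \<Rightarrow> nat) \<Rightarrow> real) \<Rightarrow> nat \<Rightarrow> nat \<Rightarrow> real" where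
  "interpolant u h k m = expectation (\<lambda>\<omega>. measure_pmf.expectation (record_vec k m)
     (\<lambda>z. h (\<lambda>l. exit_depth (tree m \<omega>) (u l) + z l)))"

text \<open>In the bound, the first summand of \<open>C\<close> comes from the trees in which all depths are at least \<open>K\<close>,
  so that the paths have separated. The second one comes from the remaining trees, whose indicator is
  at most \<open>\<Sum>l. 2 ^ K * (1/2) ^ D l\<close>.\<close>

lemma interpolant_step:
  fixes u :: "'d::finite \<Rightarrow> nat \<Rightarrow> bool"
  assumes h: "\<And>D. \<bar>h D\<bar> \<le> B" and K: "\<And>l l'. l \<noteq> l' \<Longrightarrow> \<exists>k<K. u l k \<noteq> u l' k"
  defines "C \<equiv> 2 ^ CARD('d) * real CARD('d) + (real CARD('d) + 2 ^ CARD('d)) * (real CARD('d) * 2 ^ K)"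
  shows "\<bar>interpolant u h k (Suc m) - interpolant u h (Suc k) m\<bar> \<le> 2 * B * C * (1 / (real (Suc m) * sqrt (real (Suc m))))"
proof -
  have B: "0 \<le> B" using h[of "\<lambda>_. 0"] by simp
  define p where "p = 1 / real (Suc m)"
  define H where "H D = measure_pmf.expectation (record_vec k (Suc m)) (\<lambda>z. h (\<lambda>l. D l + z l))" for D :: "'d \<Rightarrow> nat"
  have HB: "\<bar>H D\<bar> \<le> B" for D
  proof -
    have "\<bar>H D\<bar> \<le> measure_pmf.expectation (record_vec k (Suc m)) (\<lambda>z. \<bar>h (\<lambda>l. D l + z l)\<bar>)"
      unfolding H_def by (rule integral_abs_bound)
    also have "\<dots> \<le> measure_pmf.expectation (record_vec k (Suc m)) (\<lambda>z :: 'd \<Rightarrow> nat. B)"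
      by (intro integral_mono integrable_measure_pmf_finite finite_set_record_vec h)
    finally show ?thesis by simp
  qed
  let ?D = "\<lambda>T l. exit_depth T (u l)"
  define Q where "Q T = (\<Sum>v\<in>external_nodes T. H (?D (insert v T))) / real (Suc m)" for T
  define P where "P T = measure_pmf.expectation (bern_vec p) (\<lambda>b. H (\<lambda>l. ?D T l + of_bool (b l)))" for T
  have 1: "interpolant u h k (Suc m) = expectation (\<lambda>\<omega>. Q (tree m \<omega>))"
    unfolding interpolant_def H_def[symmetric] Q_def using expectation_tree_Suc[of "\<lambda>T. H (?D T)" m] .
  have 2: "interpolant u h (Suc k) m = expectation (\<lambda>\<omega>. P (tree m \<omega>))"
    unfolding interpolant_def H_def P_def p_def
    by (rule Bochner_Integration.integral_cong[OF refl]) (rule expectation_record_vec_Suc[of k m h])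
  have bnd: "\<bar>Q T - P T\<bar> \<le> 2 * B * (2 ^ CARD('d) * real CARD('d) * p\<^sup>2 +
       (real CARD('d) + 2 ^ CARD('d)) * p * (\<Sum>l\<in>UNIV. 2 ^ K * (1/2) ^ ?D T l))" if T: "T = tree m \<omega>" for T \<omega>
  proof -
    have T1: "binary_tree T" "finite (external_nodes T)" "card (external_nodes T) = Suc m"
      unfolding T by (simp_all add: binary_tree_bst card_external_nodes_bst)
    note sc = step_comparison[where u = u and B = B and g = H, OF T1 HB, folded p_def, folded Q_def P_def]
    have p: "0 \<le> p" by (simp add: p_def)
    show ?thesis
    proof (cases "\<forall>l. K \<le> ?D T l")
      case True
      have "inj (\<lambda>l. map (u l) [0..<?D T l])"
      proof (rule injI, rule ccontr)
        fix l l' assume eq: "map (u l) [0..<?D T l] = map (u l') [0..<?D T l']" and "l \<noteq> l'"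
        then obtain k where k: "k < K" "u l k \<noteq> u l' k" using K by blast
        then have "k < ?D T l" "k < ?D T l'" using True by (auto intro: less_le_trans)
        then show False using arg_cong[OF eq, of "\<lambda>xs. xs ! k"] k by simp
      qed
      then have "\<bar>Q T - P T\<bar> \<le> 2 ^ CARD('d) * real CARD('d) * (2 * B) * p\<^sup>2" by (rule sc(2))
      also have "\<dots> = 2 * B * (2 ^ CARD('d) * real CARD('d) * p\<^sup>2 + 0)" by simp
      also have "\<dots> \<le> 2 * B * (2 ^ CARD('d) * real CARD('d) * p\<^sup>2 +
         (real CARD('d) + 2 ^ CARD('d)) * p * (\<Sum>l\<in>UNIV. 2 ^ K * (1/2) ^ ?D T l))"
        using B p by (intro mult_left_mono add_left_mono mult_nonneg_nonneg sum_nonneg) auto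
      finally show ?thesis .
    next
      case False
      then obtain l where l: "?D T l \<le> K" by (meson nat_le_linear)
      have "(2 :: real) ^ ?D T l \<le> 2 ^ K" using l by (intro power_increasing) auto
      then have "1 \<le> 2 ^ K * (1/2 :: real) ^ ?D T l" by (simp add: power_one_over field_simps)
      also have "\<dots> \<le> (\<Sum>l\<in>UNIV. 2 ^ K * (1/2) ^ ?D T l)"
        by (rule member_le_sum) auto
      finally have s: "1 \<le> (\<Sum>l\<in>UNIV. 2 ^ K * (1/2 :: real) ^ ?D T l)" .
      have "\<bar>Q T - P T\<bar> \<le> 2 * B * (0 + (real CARD('d) + 2 ^ CARD('d)) * p * 1)" using sc(1) by (simp add: mult_ac)
      also have "\<dots> \<le> 2 * B * (2 ^ CARD('d) * real CARD('d) * p\<^sup>2 +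
         (real CARD('d) + 2 ^ CARD('d)) * p * (\<Sum>l\<in>UNIV. 2 ^ K * (1/2) ^ ?D T l))"
        using B p s by (intro mult_left_mono add_mono mult_nonneg_nonneg) auto
      finally show ?thesis .
    qed
  qed
  have "interpolant u h k (Suc m) - interpolant u h (Suc k) m = expectation (\<lambda>\<omega>. Q (tree m \<omega>) - P (tree m \<omega>))"
    unfolding 1 2 by (rule Bochner_Integration.integral_diff[symmetric]) (rule integrable_tree)+
  also have "\<bar>\<dots>\<bar> \<le> expectation (\<lambda>\<omega>. \<bar>Q (tree m \<omega>) - P (tree m \<omega>)\<bar>)" by (rule integral_abs_bound)
  also have "\<dots> \<le> expectation (\<lambda>\<omega>. 2 * B * (2 ^ CARD('d) * real CARD('d) * p\<^sup>2 +
       (real CARD('d) + 2 ^ CARD('d)) * p * (\<Sum>l\<in>UNIV. 2 ^ K * (1/2) ^ ?D (tree m \<omega>) l)))"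
  proof (rule integral_mono)
    show "\<bar>Q (tree m \<omega>) - P (tree m \<omega>)\<bar> \<le> 2 * B * (2 ^ CARD('d) * real CARD('d) * p\<^sup>2 +
       (real CARD('d) + 2 ^ CARD('d)) * p * (\<Sum>l\<in>UNIV. 2 ^ K * (1/2) ^ ?D (tree m \<omega>) l))" for \<omega>
      by (rule bnd[OF refl])
    show "integrable M (\<lambda>\<omega>. \<bar>Q (tree m \<omega>) - P (tree m \<omega>)\<bar>)" by (rule integrable_tree)
    show "integrable M (\<lambda>\<omega>. 2 * B * (2 ^ CARD('d) * real CARD('d) * p\<^sup>2 +
       (real CARD('d) + 2 ^ CARD('d)) * p * (\<Sum>l\<in>UNIV. 2 ^ K * (1/2) ^ ?D (tree m \<omega>) l)))"
      by (rule integrable_tree)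
  qed
  also have "\<dots> = 2 * B * (2 ^ CARD('d) * real CARD('d) * p\<^sup>2 +
       (real CARD('d) + 2 ^ CARD('d)) * p * (\<Sum>l\<in>UNIV. 2 ^ K * expectation (\<lambda>\<omega>. (1/2) ^ ?D (tree m \<omega>) l)))"
    by (simp add: integrable_tree[where g = "\<lambda>T. (1/2) ^ ?D T _"]
        integrable_tree[where g = "\<lambda>T. \<Sum>l\<in>UNIV. 2 ^ K * (1/2) ^ ?D T l"] prob_space)
  also have "\<dots> \<le> 2 * B * (2 ^ CARD('d) * real CARD('d) * (p * (1 / sqrt (real (Suc m)))) +
       (real CARD('d) + 2 ^ CARD('d)) * p * (\<Sum>l\<in>(UNIV :: 'd set). 2 ^ K * (1 / sqrt (real (Suc m)))))"
  proof (intro mult_left_mono add_mono sum_mono expectation_half_power_exit_depth)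
    have "sqrt (real (Suc m)) \<le> real (Suc m)" by (rule real_le_lsqrt) (auto simp: power2_eq_square)
    then have "p \<le> 1 / sqrt (real (Suc m))" unfolding p_def by (intro divide_left_mono) auto
    then show "p\<^sup>2 \<le> p * (1 / sqrt (real (Suc m)))"
      unfolding power2_eq_square by (intro mult_left_mono) (auto simp: p_def)
  qed (use B in \<open>auto simp: p_def\<close>)
  also have "\<dots> = 2 * B * C * (1 / (real (Suc m) * sqrt (real (Suc m))))"
    by (simp add: C_def p_def field_simps del: of_nat_Suc)
  finally show ?thesis .
qed

lemma interpolant_diff:
  fixes u :: "'d::finite \<Rightarrow> nat \<Rightarrow> bool"
  assumes h: "\<And>D. \<bar>h D\<bar> \<le> B" and K: "\<And>l l'. l \<noteq> l' \<Longrightarrow> \<exists>k<K. u l k \<noteq> u l' k"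
  defines "C \<equiv> 2 ^ CARD('d) * real CARD('d) + (real CARD('d) + 2 ^ CARD('d)) * (real CARD('d) * 2 ^ K)"
  assumes mn: "m \<le> n"
  shows "\<bar>interpolant u h 0 n - interpolant u h (n - m) m\<bar> \<le> 2 * B * C * (\<Sum>i. 1 / (real (Suc (i + m)) * sqrt (real (Suc (i + m)))))"
proof -
  let ?a = "\<lambda>i. 1 / (real (Suc i) * sqrt (real (Suc i)))"
  have B: "0 \<le> B" using h[of "\<lambda>_. 0"] by simp
  have C: "0 \<le> C" by (simp add: C_def)
  have "\<bar>interpolant u h 0 n - interpolant u h j (n - j)\<bar> \<le> 2 * B * C * (\<Sum>i\<in>{n - j..<n}. ?a i)" if "j \<le> n" for j
    using that
  proof (induction j)
    case (Suc j)
    have "\<bar>interpolant u h j (Suc (n - Suc j)) - interpolant u h (Suc j) (n - Suc j)\<bar> \<le> 2 * B * C * ?a (n - Suc j)"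
      unfolding C_def by (rule interpolant_step[OF h K])
    moreover have "Suc (n - Suc j) = n - j" using Suc by simp
    moreover have "(\<Sum>i\<in>{n - Suc j..<n}. ?a i) = ?a (n - Suc j) + (\<Sum>i\<in>{n - j..<n}. ?a i)"
      using Suc by (subst sum.atLeast_Suc_lessThan) (auto simp: Suc_diff_Suc)
    moreover have "\<bar>interpolant u h 0 n - interpolant u h j (n - j)\<bar> \<le> 2 * B * C * (\<Sum>i\<in>{n - j..<n}. ?a i)"
      using Suc by simp
    ultimately show ?case by (simp only: distrib_left) linarith
  qed simp
  from this[of "n - m"] have "\<bar>interpolant u h 0 n - interpolant u h (n - m) m\<bar> \<le> 2 * B * C * (\<Sum>i\<in>{m..<n}. ?a i)"
    using mn by simp
  also have "(\<Sum>i\<in>{m..<n}. ?a i) = (\<Sum>i<n - m. ?a (i + m))"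
    by (rule sum.reindex_bij_witness[of _ "\<lambda>i. i + m" "\<lambda>i. i - m"]) auto
  also have "\<dots> \<le> (\<Sum>i. ?a (i + m))"
  proof (rule sum_le_suminf)
    show "summable (\<lambda>i. ?a (i + m))"
      using summable_inverse_three_halves by (subst summable_iff_shift)
  qed auto
  finally show ?thesis using B C by (simp add: mult_left_mono)
qed

end

section \<open>The central limit theorem for record counts\<close>

lemma char_record_pmf:
  "(\<integral>z. iexp (\<theta> * real z) \<partial>record_pmf k m) = (\<Prod>i\<in>{m<..m+k}. 1 + (iexp \<theta> - 1) / of_nat i)"
proof (induction k arbitrary: m)
  case (Suc k)
  let ?p = "1 / real (Suc m)"
  have p: "0 \<le> ?p" "?p \<le> 1" by auto
  have I: "(\<integral>z. iexp (\<theta> * real (of_bool b + z)) \<partial>record_pmf k (Suc m)) =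
      iexp (\<theta> * of_bool b) * (\<integral>z. iexp (\<theta> * real z) \<partial>record_pmf k (Suc m))" for b
    by (subst integral_mult_right_zero[symmetric]) (auto simp: exp_add[symmetric] algebra_simps intro!: Bochner_Integration.integral_cong)
  have "(\<integral>z. iexp (\<theta> * real z) \<partial>record_pmf (Suc k) m) =
      (\<Sum>b\<in>UNIV. pmf (bernoulli_pmf ?p) b *\<^sub>R (\<integral>z. iexp (\<theta> * real (of_bool b + z)) \<partial>record_pmf k (Suc m)))"
    unfolding record_pmf.simps
    by (subst pmf_expectation_bind[of UNIV]) (auto simp: finite_set_record_pmf map_pmf_def[symmetric] simp del: of_nat_add of_nat_of_bool)
  also have "\<dots> = (1 + (iexp \<theta> - 1) / of_nat (Suc m)) * (\<integral>z. iexp (\<theta> * real z) \<partial>record_pmf k (Suc m))"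
  proof -
    have "(1 - 1 / S) * E + (1 / S) * (e * E) = (1 + (e - 1) / S) * E" if "S \<noteq> 0" for S E e :: complex
      using that by (simp add: field_simps)
    note this[of "of_nat (Suc m)"]
    then show ?thesis
      unfolding I using p by (simp add: UNIV_bool scaleR_conv_of_real of_nat_Suc[of 0] del: of_nat_Suc)
  qed
  also have "\<dots> = (1 + (iexp \<theta> - 1) / of_nat (Suc m)) * (\<Prod>i\<in>{Suc m<..Suc m+k}. 1 + (iexp \<theta> - 1) / of_nat i)"
    unfolding Suc ..
  also have "\<dots> = (\<Prod>i\<in>insert (Suc m) {Suc m<..Suc m+k}. 1 + (iexp \<theta> - 1) / of_nat i)"
    by (subst prod.insert) auto
  also have "insert (Suc m) {Suc m<..Suc m+k} = {m<..m+Suc k}" by auto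
  finally show ?case .
qed simp

lemma norm_exp_minus_linear:
  fixes z :: complex
  assumes "norm z \<le> 2"
  shows "norm (1 + z - exp z) \<le> exp 2 * (norm z)\<^sup>2"
proof -
  have "norm (exp z - (\<Sum>k\<le>1. z ^ k / fact k)) \<le> exp \<bar>Re z\<bar> * norm z ^ Suc 1 / fact 1"
    by (rule Taylor_exp)
  also have "(\<Sum>k\<le>1. z ^ k / fact k) = 1 + z" by (simp add: numeral_eq_Suc)
  also have "exp \<bar>Re z\<bar> * norm z ^ Suc 1 / fact 1 \<le> exp 2 * norm z ^ Suc 1"
    using abs_Re_le_cmod[of z] assms by (auto intro!: mult_right_mono)
  finally show ?thesis by (simp add: norm_minus_commute power2_eq_square)
qed

text \<open>The characteristic function of the record count is close to the exponential of
  \<open>w * (harm n - harm m)\<close>, since all factors on both sides have norm at most one. The minimum covers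
  the case \<open>n < m\<close>, where the product is empty.\<close>

lemma norm_prod_approx:
  fixes w :: complex
  assumes "w = iexp \<theta> - 1"
  shows "norm ((\<Prod>i\<in>{m<..n}. 1 + w / of_nat i) - exp (w * of_real (harm n - harm (min m n))))
     \<le> exp 2 * (norm w)\<^sup>2 * (\<Sum>i. 1 / (real i)\<^sup>2)"
proof -
  have w2: "norm w \<le> 2" unfolding assms using norm_triangle_ineq4[of "iexp \<theta>" 1] by simp
  have Rew: "Re w \<le> 0" unfolding assms by (simp add: Re_exp)
  have "(\<Sum>i\<in>{m<..n}. 1 / real i) = harm n - harm (min m n)"
  proof (cases "m \<le> n")
    case True
    have "{1..n} = {1..m} \<union> {m<..n}" using True by auto
    then have "harm n = harm m + (\<Sum>i\<in>{m<..n}. 1 / real i)"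
      unfolding harm_def inverse_eq_divide by (simp only:) (subst sum.union_disjoint, auto)
    then show ?thesis using True by simp
  qed simp
  then have "exp (w * of_real (harm n - harm (min m n))) = exp (\<Sum>i\<in>{m<..n}. w / of_nat i)"
    by (metis (mono_tags, lifting) of_real_1 of_real_divide of_real_of_nat_eq of_real_sum sum.cong sum_distrib_left times_divide_eq_right mult.right_neutral)
  then have e: "exp (w * of_real (harm n - harm (min m n))) = (\<Prod>i\<in>{m<..n}. exp (w / of_nat i))"
    by (simp add: exp_sum)
  have "norm ((\<Prod>i\<in>{m<..n}. 1 + w / of_nat i) - (\<Prod>i\<in>{m<..n}. exp (w / of_nat i))) \<le>
      (\<Sum>i\<in>{m<..n}. norm ((1 + w / of_nat i) - exp (w / of_nat i)))"
  proof (rule norm_prod_diff)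
    fix i assume i: "i \<in> {m<..n}"
    have "1 + w / of_nat i = of_real (1 - 1 / real i) + iexp \<theta> / of_nat i"
      using i by (simp add: assms field_simps)
    also have "norm \<dots> \<le> norm (of_real (1 - 1 / real i) :: complex) + norm (iexp \<theta> / of_nat i)"
      by (rule norm_triangle_ineq)
    also have "\<dots> = 1" using i by (simp only: norm_of_real norm_divide norm_of_nat) (simp add: field_simps)
    finally show "norm (1 + w / of_nat i) \<le> 1" .
    show "norm (exp (w / of_nat i)) \<le> 1"
      using Rew by (simp add: norm_exp_eq_Re Re_divide_of_nat divide_nonpos_nonneg)
  qed
  also have "\<dots> \<le> (\<Sum>i\<in>{m<..n}. exp 2 * (norm w)\<^sup>2 * (1 / (real i)\<^sup>2))"
  proof (rule sum_mono)
    fix i assume i: "i \<in> {m<..n}"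
    have "norm (w / of_nat i) \<le> norm w / 1"
      unfolding norm_divide norm_of_nat by (rule divide_left_mono) (use i in auto)
    then have "norm ((1 + w / of_nat i) - exp (w / of_nat i)) \<le> exp 2 * (norm (w / of_nat i))\<^sup>2"
      using w2 by (intro norm_exp_minus_linear) simp
    then show "norm ((1 + w / of_nat i) - exp (w / of_nat i)) \<le> exp 2 * (norm w)\<^sup>2 * (1 / (real i)\<^sup>2)"
      by (simp add: norm_divide power_divide)
  qed
  also have "\<dots> = exp 2 * (norm w)\<^sup>2 * (\<Sum>i\<in>{m<..n}. 1 / (real i)\<^sup>2)" by (simp add: sum_distrib_left)
  also have "\<dots> \<le> exp 2 * (norm w)\<^sup>2 * (\<Sum>i. 1 / (real i)\<^sup>2)"
    using inverse_power_summable[of 2, where 'a=real]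
    by (intro mult_left_mono sum_le_suminf) (auto simp: inverse_eq_divide)
  finally show ?thesis unfolding e .
qed

text \<open>The distribution of \<open>(c + Z - ln n) / sqrt (ln n)\<close>, where \<open>Z\<close> counts the records at the times
  \<open>m + 1, \<dots>, n\<close>, and \<open>c\<close> is a fixed offset; for \<open>n \<le> m\<close> there are no such times, and \<open>Z = 0\<close>.\<close>

abbreviation (input) normalized_record :: "nat \<Rightarrow> nat \<Rightarrow> nat \<Rightarrow> real measure" where
  "normalized_record m c n \<equiv> distr (measure_pmf (record_pmf (n - m) m)) borel
     (\<lambda>z. (real (c + z) - ln (real n)) / sqrt (ln (real n)))"

lemma char_normalized_record:
  assumes "n \<ge> m" "\<theta> = t / sqrt (ln (real n))"
  shows "char (normalized_record m c n) t = iexp (\<theta> * (real c - ln (real n))) * (\<Prod>i\<in>{m<..n}. 1 + (iexp \<theta> - 1) / of_nat i)"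
proof -
  have "char (normalized_record m c n) t = (\<integral>z. iexp (t * ((real (c + z) - ln (real n)) / sqrt (ln (real n)))) \<partial>record_pmf (n - m) m)"
    unfolding char_def by (subst integral_distr) auto
  also have "\<dots> = (\<integral>z. iexp (\<theta> * (real c - ln (real n))) * iexp (\<theta> * real z) \<partial>record_pmf (n - m) m)"
  proof (rule Bochner_Integration.integral_cong)
    fix z
    have "t * ((real (c + z) - ln (real n)) / sqrt (ln (real n))) = \<theta> * (real c - ln (real n)) + \<theta> * real z"
      by (simp add: assms add_divide_distrib diff_divide_distrib algebra_simps)
    then show "iexp (t * ((real (c + z) - ln (real n)) / sqrt (ln (real n)))) = iexp (\<theta> * (real c - ln (real n))) * iexp (\<theta> * real z)"
      by (simp only: of_real_add distrib_left exp_add)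
  qed simp
  also have "\<dots> = iexp (\<theta> * (real c - ln (real n))) * (\<Prod>i\<in>{m<..n}. 1 + (iexp \<theta> - 1) / of_nat i)"
    using assms(1) by (subst integral_mult_right_zero) (simp only: char_record_pmf le_add_diff_inverse)
  finally show ?thesis .
qed

text \<open>With \<open>\<theta> = t / sqrt (ln n)\<close> and \<open>w = iexp \<theta> - 1\<close>, the exponent is \<open>(w - \<i> * \<theta>) * ln n\<close> up to terms that
  vanish in the limit, and \<open>w - \<i> * \<theta>\<close> is asymptotically \<open>- \<theta>\<^sup>2 / 2\<close>.\<close>

lemma char_normalized_record_limit:
  "(\<lambda>n. char (normalized_record m c n) t) \<longlonglongrightarrow> exp (- (complex_of_real t)\<^sup>2 / 2)"
proof -
  define \<theta> where "\<theta> n = t / sqrt (ln (real n))" for n :: nat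
  define w where "w n = iexp (\<theta> n) - 1" for n
  have \<theta>0: "\<theta> \<longlonglongrightarrow> 0" unfolding \<theta>_def by real_asymp
  have w0: "w \<longlonglongrightarrow> 0" unfolding w_def
    by (rule tendsto_eq_intros \<theta>0 | simp)+
  have \<theta>2: "\<forall>\<^sub>F n in sequentially. (\<theta> n)\<^sup>2 * ln (real n) = t\<^sup>2"
    using eventually_gt_at_top[of 1]
  proof eventually_elim
    case (elim n)
    then have "ln (real n) > 0" by simp
    then show ?case by (simp add: \<theta>_def power_divide)
  qed
  have quad: "(\<lambda>n. (w n - \<i> * \<theta> n) * of_real (ln (real n))) \<longlonglongrightarrow> - (of_real t)\<^sup>2 / 2"
  proof (rule Lim_null[THEN iffD2], rule Lim_null_comparison)
    show "\<forall>\<^sub>F n in sequentially. norm ((w n - \<i> * \<theta> n) * of_real (ln (real n)) - - (of_real t)\<^sup>2 / 2) \<le> t\<^sup>2 * \<bar>\<theta> n\<bar>"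
      using \<theta>2 eventually_gt_at_top[of 1]
    proof eventually_elim
      case (elim n)
      have ln: "ln (real n) > 0" using elim by simp
      have "norm (iexp (\<theta> n) - (\<Sum>k\<le>2. (\<i> * \<theta> n) ^ k / fact k)) \<le> \<bar>\<theta> n\<bar> ^ Suc 2 / fact (Suc 2)"
        by (rule iexp_approx1)
      also have "(\<Sum>k\<le>2. (\<i> * \<theta> n) ^ k / fact k) = 1 + \<i> * \<theta> n - of_real ((\<theta> n)\<^sup>2) / 2"
        by (simp add: numeral_eq_Suc power_mult_distrib)
      finally have b: "norm (w n - \<i> * \<theta> n + of_real ((\<theta> n)\<^sup>2) / 2) \<le> \<bar>\<theta> n\<bar> ^ 3 / 6"
        by (simp add: w_def algebra_simps fact_numeral)
      have "(of_real t)\<^sup>2 = of_real ((\<theta> n)\<^sup>2) * complex_of_real (ln (real n))"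
        using elim(1) by (metis of_real_mult of_real_power)
      then have "(w n - \<i> * \<theta> n) * of_real (ln (real n)) - - (of_real t)\<^sup>2 / 2 =
          (w n - \<i> * \<theta> n + of_real ((\<theta> n)\<^sup>2) / 2) * of_real (ln (real n))"
        by (simp add: algebra_simps)
      also have "norm \<dots> \<le> \<bar>\<theta> n\<bar> ^ 3 / 6 * ln (real n)"
        using b ln by (simp add: norm_mult mult_right_mono)
      also have "\<dots> = \<bar>\<theta> n\<bar> * ((\<theta> n)\<^sup>2 * ln (real n)) / 6"
        by (simp add: power3_eq_cube power2_eq_square)
      also have "\<dots> \<le> t\<^sup>2 * \<bar>\<theta> n\<bar>" unfolding elim(1) by (simp add: field_simps)
      finally show ?case .
    qed
    show "(\<lambda>n. t\<^sup>2 * \<bar>\<theta> n\<bar>) \<longlonglongrightarrow> 0" by (rule tendsto_eq_intros \<theta>0 | simp)+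
  qed
  have harm: "(\<lambda>n. harm n - ln (real n)) \<longlonglongrightarrow> (euler_mascheroni :: real)" by (rule euler_mascheroni_LIMSEQ)
  define e where "e n = iexp (\<theta> n * (real c - ln (real n)))" for n
  have e1: "norm (e n) = 1" for n by (simp add: e_def)
  have main: "(\<lambda>n. e n * exp (w n * of_real (harm n - harm m))) \<longlonglongrightarrow> exp (- (complex_of_real t)\<^sup>2 / 2)"
  proof -
    have "(\<lambda>n. exp (\<i> * \<theta> n * c + w n * of_real (harm n - ln (real n) - harm m) + (w n - \<i> * \<theta> n) * of_real (ln (real n))))
        \<longlonglongrightarrow> exp (\<i> * of_real 0 * c + 0 * of_real (euler_mascheroni - harm m) + - (of_real t)\<^sup>2 / 2)"
      by (intro tendsto_intros \<theta>0 w0 quad harm)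
    moreover have "exp (\<i> * \<theta> n * c + w n * of_real (harm n - ln (real n) - harm m) + (w n - \<i> * \<theta> n) * of_real (ln (real n))) =
       e n * exp (w n * of_real (harm n - harm m))" for n
      unfolding e_def exp_add[symmetric] by (rule arg_cong[of _ _ exp]) (simp add: algebra_simps)
    ultimately show ?thesis by simp
  qed
  have diff: "(\<lambda>n. e n * ((\<Prod>i\<in>{m<..n}. 1 + w n / of_nat i) - exp (w n * of_real (harm n - harm m)))) \<longlonglongrightarrow> 0"
  proof (rule Lim_null_comparison)
    show "\<forall>\<^sub>F n in sequentially. norm (e n * ((\<Prod>i\<in>{m<..n}. 1 + w n / of_nat i) - exp (w n * of_real (harm n - harm m)))) \<le>
        exp 2 * (norm (w n))\<^sup>2 * (\<Sum>i. 1 / (real i)\<^sup>2)"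
      using eventually_ge_at_top[of m]
    proof eventually_elim
      case (elim n)
      then show ?case using norm_prod_approx[of "w n" "\<theta> n" m n] by (simp add: norm_mult e1 w_def min_absorb1)
    qed
    show "(\<lambda>n. exp 2 * (norm (w n))\<^sup>2 * (\<Sum>i. 1 / (real i)\<^sup>2)) \<longlonglongrightarrow> 0"
      by (rule tendsto_eq_intros w0 | simp)+
  qed
  have "(\<lambda>n. e n * (\<Prod>i\<in>{m<..n}. 1 + w n / of_nat i)) \<longlonglongrightarrow> exp (- (complex_of_real t)\<^sup>2 / 2)"
    using tendsto_add[OF diff main] by (simp add: algebra_simps)
  moreover have "\<forall>\<^sub>F n in sequentially. e n * (\<Prod>i\<in>{m<..n}. 1 + w n / of_nat i) = char (normalized_record m c n) t"
    using eventually_ge_at_top[of m]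
    by eventually_elim (simp only: char_normalized_record[OF _ \<theta>_def] e_def w_def)
  ultimately show ?thesis by (rule Lim_transform_eventually)
qed

lemma real_distribution_normalized_record: "real_distribution (normalized_record m c n)"
  by (rule prob_space.real_distribution_distr[OF measure_pmf.prob_space_axioms]) simp

theorem normalized_record_weak_conv:
  "weak_conv_m (normalized_record m c) std_normal_distribution"
proof (rule levy_continuity)
  show "(\<lambda>n. char (normalized_record m c n) t) \<longlonglongrightarrow> char std_normal_distribution t" for t
    using char_normalized_record_limit[of m c t] by (simp add: char_std_normal_distribution exp_of_real[symmetric])
qed (rule real_distribution_normalized_record real_dist_normal_dist)+

section \<open>Joint convergence of independent components\<close>

lemma measurable_vec_lambda:
  "(\<lambda>x. \<chi> l. x l) \<in> (\<Pi>\<^sub>M l\<in>(UNIV :: 'd::finite set). (borel :: real measure)) \<rightarrow>\<^sub>M borel"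
proof (subst borel_measurable_euclidean_space, rule ballI)
  fix b :: "real ^ 'd" assume "b \<in> Basis"
  then obtain i where b: "b = axis i 1" by (auto simp: Basis_vec_def)
  show "(\<lambda>x. (\<chi> l. x l) \<bullet> b) \<in> borel_measurable (\<Pi>\<^sub>M l\<in>(UNIV :: 'd set). (borel :: real measure))"
    unfolding b by (simp add: inner_axis measurable_component_singleton)
qed

lemma lborel_vec_eq:
  "(lborel :: (real ^ 'd::finite) measure) = distr (\<Pi>\<^sub>M l\<in>UNIV. lborel) borel (\<lambda>x. \<chi> l. x l)"
proof (rule lborel_eqI)
  interpret product_sigma_finite "\<lambda>_ :: 'd. lborel :: real measure" ..
  have meas: "(\<lambda>x. \<chi> l. x l) \<in> (\<Pi>\<^sub>M l\<in>(UNIV :: 'd set). (lborel :: real measure)) \<rightarrow>\<^sub>M borel"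
    using measurable_vec_lambda by (simp cong: measurable_cong_sets sets_PiM_cong)
  fix a b :: "real ^ 'd" assume ab: "\<And>i. i \<in> Basis \<Longrightarrow> a \<bullet> i \<le> b \<bullet> i"
  have le: "a $ l \<le> b $ l" for l using ab[of "axis l 1"] by (simp add: inner_axis axis_in_Basis_iff)
  have "emeasure (distr (\<Pi>\<^sub>M l\<in>UNIV. lborel) borel (\<lambda>x. \<chi> l. x l)) (box a b) =
     emeasure (\<Pi>\<^sub>M l\<in>UNIV. lborel) ((\<lambda>x. \<chi> l. x l) -` box a b \<inter> space (\<Pi>\<^sub>M l\<in>(UNIV :: 'd set). (lborel :: real measure)))"
    by (rule emeasure_distr[OF meas]) simp
  also have "(\<lambda>x. \<chi> l. x l) -` box a b \<inter> space (\<Pi>\<^sub>M l\<in>(UNIV :: 'd set). (lborel :: real measure)) = (\<Pi>\<^sub>E l\<in>UNIV. {a $ l <..< b $ l})"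
    by (auto simp: space_PiM mem_box_cart PiE_iff)
  also have "emeasure (\<Pi>\<^sub>M l\<in>UNIV. lborel) \<dots> = (\<Prod>l\<in>UNIV. emeasure lborel {a $ l <..< b $ l})"
    by (rule emeasure_PiM) auto
  also have "\<dots> = (\<Prod>l\<in>UNIV. ennreal (b $ l - a $ l))" using le by simp
  also have "\<dots> = ennreal (\<Prod>l\<in>UNIV. b $ l - a $ l)" using le by (intro prod_ennreal) simp
  also have "(\<Prod>l\<in>UNIV. b $ l - a $ l) = (\<Prod>i\<in>Basis. (b - a) \<bullet> i)"
  proof -
    have B: "(Basis :: (real ^ 'd) set) = range (\<lambda>l. axis l 1)" by (auto simp: Basis_vec_def)
    have "inj (\<lambda>l :: 'd. axis l (1 :: real))" by (auto simp: inj_def axis_eq_axis)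
    then show ?thesis unfolding B by (subst prod.reindex) (simp_all add: inner_axis)
  qed
  finally show "emeasure (distr (\<Pi>\<^sub>M l\<in>UNIV. lborel) borel (\<lambda>x. \<chi> l. x l)) (box a b) = ennreal (\<Prod>i\<in>Basis. (b - a) \<bullet> i)" .
qed simp

lemma PiM_std_normal:
  "(\<Pi>\<^sub>M l\<in>(UNIV :: 'd::finite set). std_normal_distribution) =
     density (\<Pi>\<^sub>M l\<in>UNIV. lborel) (\<lambda>x. ennreal (\<Prod>l\<in>UNIV. std_normal_density (x l)))"
proof (rule sym, rule product_sigma_finite.PiM_eqI)
  interpret L: product_sigma_finite "\<lambda>_ :: 'd. lborel :: real measure" ..
  interpret N: product_prob_space "\<lambda>_ :: 'd. std_normal_distribution"
    by (intro product_prob_spaceI prob_space_normal_density) simp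
  show "product_sigma_finite (\<lambda>_ :: 'd. std_normal_distribution)" ..
  show "sets (density (\<Pi>\<^sub>M l\<in>UNIV. lborel) (\<lambda>x. ennreal (\<Prod>l\<in>(UNIV :: 'd set). std_normal_density (x l)))) =
      sets (\<Pi>\<^sub>M l\<in>(UNIV :: 'd set). std_normal_distribution)"
    by (simp cong: sets_PiM_cong)
  fix A :: "'d \<Rightarrow> real set" assume A: "\<And>l. l \<in> UNIV \<Longrightarrow> A l \<in> sets std_normal_distribution"
  then have [measurable]: "A l \<in> sets borel" for l by simp
  let ?P = "\<Pi>\<^sub>M l\<in>(UNIV :: 'd set). (lborel :: real measure)"
  have PA: "Pi\<^sub>E UNIV A \<in> sets ?P" by (rule sets_PiM_I_finite) auto
  have "emeasure (density ?P (\<lambda>x. ennreal (\<Prod>l\<in>UNIV. std_normal_density (x l)))) (Pi\<^sub>E UNIV A) =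
      (\<integral>\<^sup>+x. ennreal (\<Prod>l\<in>UNIV. std_normal_density (x l)) * indicator (Pi\<^sub>E UNIV A) x \<partial>?P)"
    by (rule emeasure_density[OF _ PA]) measurable
  also have "\<dots> = (\<integral>\<^sup>+x. (\<Prod>l\<in>UNIV. ennreal (std_normal_density (x l)) * indicator (A l) (x l)) \<partial>?P)"
  proof (rule nn_integral_cong)
    fix x :: "'d \<Rightarrow> real"
    have "indicator (Pi\<^sub>E UNIV A) x = (\<Prod>l\<in>UNIV. indicator (A l) (x l) :: ennreal)"
      by (auto simp: indicator_def PiE_iff)
    then show "ennreal (\<Prod>l\<in>UNIV. std_normal_density (x l)) * indicator (Pi\<^sub>E UNIV A) x =
      (\<Prod>l\<in>UNIV. ennreal (std_normal_density (x l)) * indicator (A l) (x l))"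
      by (simp add: prod_ennreal[symmetric] prod.distrib)
  qed
  also have "\<dots> = (\<Prod>l\<in>UNIV. \<integral>\<^sup>+x. ennreal (std_normal_density x) * indicator (A l) x \<partial>lborel)"
    by (rule L.product_nn_integral_prod) auto
  also have "\<dots> = (\<Prod>l\<in>UNIV. emeasure std_normal_distribution (A l))"
    by (rule prod.cong) (auto simp: emeasure_density)
  finally show "emeasure (density ?P (\<lambda>x. ennreal (\<Prod>l\<in>UNIV. std_normal_density (x l)))) (Pi\<^sub>E UNIV A) =
    (\<Prod>l\<in>UNIV. emeasure std_normal_distribution (A l))" .
qed simp

lemma std_normal_vec_eq_distr:
  "(std_normal_vec :: (real ^ 'd::finite) measure) =
     distr (\<Pi>\<^sub>M l\<in>UNIV. std_normal_distribution) borel (\<lambda>x. \<chi> l. x l)"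
proof -
  have meas: "(\<lambda>x. \<chi> l. x l) \<in> (\<Pi>\<^sub>M l\<in>(UNIV :: 'd set). (lborel :: real measure)) \<rightarrow>\<^sub>M borel"
    using measurable_vec_lambda by (simp cong: measurable_cong_sets sets_PiM_cong)
  show ?thesis
    unfolding std_normal_vec_def PiM_std_normal
    by (subst lborel_vec_eq, subst density_distr[OF _ meas]) auto
qed

lemma distr_PiM_componentwise:
  fixes Y :: "'d::finite \<Rightarrow> 'a \<Rightarrow> real"
  assumes "\<And>l. prob_space (\<Omega> l)" and Y: "\<And>l. Y l \<in> borel_measurable (\<Omega> l)"
  shows "distr (\<Pi>\<^sub>M l\<in>UNIV. \<Omega> l) (\<Pi>\<^sub>M l\<in>UNIV. borel) (\<lambda>\<omega>. \<lambda>l\<in>UNIV. Y l (\<omega> l)) = (\<Pi>\<^sub>M l\<in>UNIV. distr (\<Omega> l) borel (Y l))"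
proof (rule product_sigma_finite.PiM_eqI)
  interpret O: product_prob_space \<Omega> by (rule product_prob_spaceI) fact
  interpret D: product_prob_space "\<lambda>l. distr (\<Omega> l) borel (Y l)"
    by (intro product_prob_spaceI prob_space.prob_space_distr assms)
  show "product_sigma_finite (\<lambda>l. distr (\<Omega> l) borel (Y l))" ..
  show "sets (distr (\<Pi>\<^sub>M l\<in>UNIV. \<Omega> l) (\<Pi>\<^sub>M l\<in>UNIV. borel) (\<lambda>\<omega>. \<lambda>l\<in>UNIV. Y l (\<omega> l))) = sets (\<Pi>\<^sub>M l\<in>UNIV. distr (\<Omega> l) borel (Y l))"
    by (simp cong: sets_PiM_cong)
  fix A assume A: "\<And>l. l \<in> UNIV \<Longrightarrow> A l \<in> sets (distr (\<Omega> l) borel (Y l))"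
  have m: "(\<lambda>\<omega>. \<lambda>l\<in>UNIV. Y l (\<omega> l)) \<in> (\<Pi>\<^sub>M l\<in>UNIV. \<Omega> l) \<rightarrow>\<^sub>M (\<Pi>\<^sub>M l\<in>UNIV. borel)"
  proof (rule measurable_restrict)
    show "(\<lambda>\<omega>. Y l (\<omega> l)) \<in> borel_measurable (\<Pi>\<^sub>M l\<in>UNIV. \<Omega> l)" for l
      by (rule measurable_compose[of "\<lambda>\<omega>. \<omega> l", OF _ Y]) simp
  qed
  have "emeasure (distr (\<Pi>\<^sub>M l\<in>UNIV. \<Omega> l) (\<Pi>\<^sub>M l\<in>UNIV. borel) (\<lambda>\<omega>. \<lambda>l\<in>UNIV. Y l (\<omega> l))) (Pi\<^sub>E UNIV A) =
     emeasure (\<Pi>\<^sub>M l\<in>UNIV. \<Omega> l) ((\<lambda>\<omega>. \<lambda>l\<in>UNIV. Y l (\<omega> l)) -` Pi\<^sub>E UNIV A \<inter> space (\<Pi>\<^sub>M l\<in>UNIV. \<Omega> l))"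
    by (rule emeasure_distr[OF m]) (use A in \<open>auto intro!: sets_PiM_I_finite\<close>)
  also have "(\<lambda>\<omega>. \<lambda>l\<in>UNIV. Y l (\<omega> l)) -` Pi\<^sub>E UNIV A \<inter> space (\<Pi>\<^sub>M l\<in>UNIV. \<Omega> l) = (\<Pi>\<^sub>E l\<in>UNIV. Y l -` A l \<inter> space (\<Omega> l))"
    by (auto simp: space_PiM PiE_iff)
  also have "emeasure (\<Pi>\<^sub>M l\<in>UNIV. \<Omega> l) \<dots> = (\<Prod>l\<in>UNIV. emeasure (\<Omega> l) (Y l -` A l \<inter> space (\<Omega> l)))"
    by (rule O.emeasure_PiM) (use A Y in auto)
  also have "\<dots> = (\<Prod>l\<in>UNIV. emeasure (distr (\<Omega> l) borel (Y l)) (A l))"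
    by (rule prod.cong) (use A Y in \<open>auto simp: emeasure_distr\<close>)
  finally show "emeasure (distr (\<Pi>\<^sub>M l\<in>UNIV. \<Omega> l) (\<Pi>\<^sub>M l\<in>UNIV. borel) (\<lambda>\<omega>. \<lambda>l\<in>UNIV. Y l (\<omega> l))) (Pi\<^sub>E UNIV A) =
    (\<Prod>l\<in>UNIV. emeasure (distr (\<Omega> l) borel (Y l)) (A l))" .
qed simp

lemma distr_Pi_pmf_componentwise:
  fixes X :: "'d::finite \<Rightarrow> 'b \<Rightarrow> real"
  shows "distr (measure_pmf (Pi_pmf UNIV dflt p)) (\<Pi>\<^sub>M l\<in>UNIV. borel) (\<lambda>z. \<lambda>l\<in>UNIV. X l (z l)) =
    (\<Pi>\<^sub>M l\<in>UNIV. distr (measure_pmf (p l)) borel (X l))"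
proof -
  let ?P = "Pi_pmf (UNIV :: 'd set) dflt p"
  have "prob_space.indep_vars (measure_pmf ?P) (\<lambda>_. borel) (\<lambda>l z. X l (z l)) UNIV"
    using prob_space.indep_vars_compose2[OF measure_pmf.prob_space_axioms indep_vars_Pi_pmf[of "UNIV :: 'd set" dflt p], of X "\<lambda>_. borel"] by simp
  then have "distr (measure_pmf ?P) (\<Pi>\<^sub>M l\<in>UNIV. borel) (\<lambda>z. \<lambda>l\<in>UNIV. X l (z l)) =
      (\<Pi>\<^sub>M l\<in>UNIV. distr (measure_pmf ?P) borel (\<lambda>z. X l (z l)))"
    by (subst (asm) prob_space.indep_vars_iff_distr_eq_PiM'[OF measure_pmf.prob_space_axioms]) auto
  moreover have "distr (measure_pmf ?P) borel (\<lambda>z. X l (z l)) = distr (measure_pmf (p l)) borel (X l)" for l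
  proof -
    have "p l = map_pmf (\<lambda>f. f l) ?P" by (simp add: Pi_pmf_component)
    then have "distr (measure_pmf (p l)) borel (X l) = distr (distr (measure_pmf ?P) (count_space UNIV) (\<lambda>f. f l)) borel (X l)"
      by (simp add: map_pmf_rep_eq)
    also have "\<dots> = distr (measure_pmf ?P) borel (X l \<circ> (\<lambda>f. f l))" by (rule distr_distr) auto
    finally show ?thesis by (simp add: comp_def)
  qed
  ultimately show ?thesis by simp
qed

text \<open>If the components are independent and each of them converges to the standard normal
  distribution, then the vectors converge to the standard normal distribution of that dimension. By
  Skorohod's theorem the components may be assumed to converge pointwise.\<close>

theorem product_weak_conv:
  fixes X :: "nat \<Rightarrow> 'd::finite \<Rightarrow> 'b \<Rightarrow> real" and f :: "real ^ 'd \<Rightarrow> real"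
  assumes conv: "\<And>l. weak_conv_m (\<lambda>n. distr (measure_pmf (p n l)) borel (X n l)) std_normal_distribution"
    and f: "continuous_on UNIV f" "bounded (range f)"
  shows "(\<lambda>n. measure_pmf.expectation (Pi_pmf UNIV dflt (p n)) (\<lambda>z. f (\<chi> l. X n l (z l)))) \<longlonglongrightarrow>
    (\<integral>x. f x \<partial>std_normal_vec)"
proof -
  have "\<exists>(\<Omega> :: real measure) (Y_seq :: nat \<Rightarrow> real \<Rightarrow> real) (Y :: real \<Rightarrow> real).
    prob_space \<Omega> \<and> (\<forall>n. Y_seq n \<in> measurable \<Omega> borel) \<and>
    (\<forall>n. distr \<Omega> borel (Y_seq n) = distr (measure_pmf (p n l)) borel (X n l)) \<and>
    Y \<in> measurable \<Omega> lborel \<and> distr \<Omega> borel Y = std_normal_distribution \<and>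
    (\<forall>x \<in> space \<Omega>. (\<lambda>n. Y_seq n x) \<longlonglongrightarrow> Y x)" for l
    by (rule Skorohod[OF _ _ conv]) (auto intro!: prob_space.real_distribution_distr measure_pmf.prob_space_axioms real_dist_normal_dist)
  then obtain \<Omega> :: "'d \<Rightarrow> real measure" and Ys :: "'d \<Rightarrow> nat \<Rightarrow> real \<Rightarrow> real" and Y :: "'d \<Rightarrow> real \<Rightarrow> real" where
    \<Omega>: "\<And>l. prob_space (\<Omega> l)" and Ys: "\<And>l n. Ys l n \<in> borel_measurable (\<Omega> l)"
    and dYs: "\<And>l n. distr (\<Omega> l) borel (Ys l n) = distr (measure_pmf (p n l)) borel (X n l)"
    and Y: "\<And>l. Y l \<in> borel_measurable (\<Omega> l)" and dY: "\<And>l. distr (\<Omega> l) borel (Y l) = std_normal_distribution"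
    and lim: "\<And>l x. x \<in> space (\<Omega> l) \<Longrightarrow> (\<lambda>n. Ys l n x) \<longlonglongrightarrow> Y l x"
    by (simp add: choice_iff) metis
  let ?P = "\<Pi>\<^sub>M l\<in>UNIV. \<Omega> l" and ?B = "\<Pi>\<^sub>M l\<in>(UNIV :: 'd set). (borel :: real measure)"
  interpret P: prob_space ?P by (intro prob_space_PiM \<Omega>)
  have fm: "f \<in> borel_measurable borel" using f(1) by (rule borel_measurable_continuous_onI)
  have fv: "(\<lambda>x. f (\<chi> l. x l)) \<in> borel_measurable ?B"
    by (rule measurable_compose[OF measurable_vec_lambda fm])
  have m: "(\<lambda>\<omega>. \<lambda>l\<in>UNIV. Z l (\<omega> l)) \<in> ?P \<rightarrow>\<^sub>M ?B" if "\<And>l. Z l \<in> borel_measurable (\<Omega> l)" for Z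
  proof (rule measurable_restrict)
    show "(\<lambda>\<omega>. Z l (\<omega> l)) \<in> borel_measurable ?P" for l
      by (rule measurable_compose[of "\<lambda>\<omega>. \<omega> l", OF _ that]) simp
  qed
  have fZ: "(\<integral>\<omega>. f (\<chi> l. Z l (\<omega> l)) \<partial>?P) = (\<integral>x. f (\<chi> l. x l) \<partial>(\<Pi>\<^sub>M l\<in>UNIV. distr (\<Omega> l) borel (Z l)))"
    and fZm: "(\<lambda>\<omega>. f (\<chi> l. Z l (\<omega> l))) \<in> borel_measurable ?P"
    if Z: "\<And>l. Z l \<in> borel_measurable (\<Omega> l)" for Z
  proof -
    show "(\<integral>\<omega>. f (\<chi> l. Z l (\<omega> l)) \<partial>?P) = (\<integral>x. f (\<chi> l. x l) \<partial>(\<Pi>\<^sub>M l\<in>UNIV. distr (\<Omega> l) borel (Z l)))"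
      unfolding distr_PiM_componentwise[OF \<Omega> Z, symmetric]
      by (subst integral_distr[OF m[OF Z] fv]) (simp add: restrict_UNIV)
    show "(\<lambda>\<omega>. f (\<chi> l. Z l (\<omega> l))) \<in> borel_measurable ?P"
      using measurable_compose[OF m[OF Z] fv] by simp
  qed
  obtain C where C: "\<And>x. \<bar>f x\<bar> \<le> C" using f(2) by (auto simp: bounded_iff)
  have "(\<lambda>n. \<integral>\<omega>. f (\<chi> l. Ys l n (\<omega> l)) \<partial>?P) \<longlonglongrightarrow> (\<integral>\<omega>. f (\<chi> l. Y l (\<omega> l)) \<partial>?P)"
  proof (rule integral_dominated_convergence[where w = "\<lambda>_. C"])
    show "AE \<omega> in ?P. (\<lambda>n. f (\<chi> l. Ys l n (\<omega> l))) \<longlonglongrightarrow> f (\<chi> l. Y l (\<omega> l))"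
    proof (rule AE_I2)
      fix \<omega> assume "\<omega> \<in> space ?P"
      then have "\<omega> l \<in> space (\<Omega> l)" for l by (auto simp: space_PiM)
      then have "(\<lambda>n. \<chi> l. Ys l n (\<omega> l)) \<longlonglongrightarrow> (\<chi> l. Y l (\<omega> l))"
        by (intro tendsto_vec_lambda lim)
      then show "(\<lambda>n. f (\<chi> l. Ys l n (\<omega> l))) \<longlonglongrightarrow> f (\<chi> l. Y l (\<omega> l))"
        by (rule continuous_on_tendsto_compose[OF f(1)]) auto
    qed
  qed (use C Ys Y in \<open>auto intro!: fZm\<close>)
  moreover have "(\<integral>\<omega>. f (\<chi> l. Y l (\<omega> l)) \<partial>?P) = (\<integral>x. f x \<partial>std_normal_vec)"
    unfolding fZ[OF Y] dY std_normal_vec_eq_distr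
    by (rule integral_distr[symmetric, OF _ fm]) (use measurable_vec_lambda in \<open>simp cong: measurable_cong_sets sets_PiM_cong\<close>)
  moreover have "(\<integral>\<omega>. f (\<chi> l. Ys l n (\<omega> l)) \<partial>?P) =
      measure_pmf.expectation (Pi_pmf UNIV dflt (p n)) (\<lambda>z. f (\<chi> l. X n l (z l)))" for n
    unfolding fZ[OF Ys] dYs distr_Pi_pmf_componentwise[symmetric, where dflt = dflt]
    by (subst integral_distr[OF _ fv]) (auto simp: restrict_UNIV space_PiM)
  ultimately show ?thesis by simp
qed

section \<open>Convergence of the silhouette\<close>

lemma silhouette_eq_exit_depth: "silhouette T s = exit_depth T (binary_digits s)"
  by (simp add: silhouette_def exit_depth_def)

lemma binary_digits_inj:
  assumes "s \<in> {0..1}" "t \<in> {0..1}" "binary_digits s = binary_digits t"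
  shows "s = t"
proof -
  have "is_binary_expansion x (binary_digits x)" if "x \<in> {0..1}" for x
    unfolding binary_digits_def by (rule theI'[OF ex1_binary_expansion]) (use that in auto)
  from this[OF assms(1)] this[OF assms(2)] show ?thesis
    unfolding is_binary_expansion_def assms(3) using sums_unique2 by blast
qed

text \<open>Finitely many distinct digit sequences are distinguished by their first \<open>K\<close> digits.\<close>

lemma uniform_separation:
  fixes u :: "'d::finite \<Rightarrow> nat \<Rightarrow> bool"
  assumes "inj u"
  obtains K where "\<And>l l'. l \<noteq> l' \<Longrightarrow> \<exists>k<K. u l k \<noteq> u l' k"
proof -
  have "\<exists>k. u l k \<noteq> u l' k" if "l \<noteq> l'" for l l'
  proof -
    have "u l \<noteq> u l'" using assms that by (simp add: inj_eq)
    then show ?thesis by (simp add: fun_eq_iff)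
  qed
  then obtain k where k: "\<And>l l'. l \<noteq> l' \<Longrightarrow> u l (k l l') \<noteq> u l' (k l l')" by metis
  have "k l l' < Suc (Max (range (\<lambda>(l, l'). k l l')))" for l l'
    unfolding less_Suc_eq_le by (rule Max_ge) (auto intro!: rev_image_eqI[of "(l, l')"])
  then show ?thesis using k by (intro that) blast
qed

context iid_keys
begin

text \<open>For fixed \<open>m\<close> the depths at time \<open>m\<close> are an offset that does not affect the limit.\<close>

lemma interpolant_limit:
  fixes u :: "'d::finite \<Rightarrow> nat \<Rightarrow> bool" and f :: "real ^ 'd \<Rightarrow> real"
  assumes f: "continuous_on UNIV f" "bounded (range f)"
  shows "(\<lambda>n. interpolant u (\<lambda>D. f (\<chi> l. (real (D l) - ln (real n)) / sqrt (ln (real n)))) (n - m) m)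
    \<longlonglongrightarrow> (\<integral>x. f x \<partial>std_normal_vec)"
proof -
  obtain B where B: "\<And>x. \<bar>f x\<bar> \<le> B" using f(2) by (auto simp: bounded_iff)
  let ?e = "\<lambda>n \<omega>. measure_pmf.expectation (record_vec (n - m) m)
     (\<lambda>z. f (\<chi> l. (real (exit_depth (tree m \<omega>) (u l) + z l) - ln (real n)) / sqrt (ln (real n))))"
  have "(\<lambda>n. expectation (?e n)) \<longlonglongrightarrow> expectation (\<lambda>\<omega>. \<integral>x. f x \<partial>(std_normal_vec :: (real ^ 'd) measure))"
  proof (rule integral_dominated_convergence[where w = "\<lambda>_. B"])
    show "AE \<omega> in M. (\<lambda>n. ?e n \<omega>) \<longlonglongrightarrow> (\<integral>x. f x \<partial>std_normal_vec)"
    proof (rule AE_I2)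
      fix \<omega>
      show "(\<lambda>n. ?e n \<omega>) \<longlonglongrightarrow> (\<integral>x. f x \<partial>std_normal_vec)"
        unfolding record_vec_def
        by (rule product_weak_conv[where p = "\<lambda>n _. record_pmf (n - m) m", OF normalized_record_weak_conv f])
    qed
    fix n
    show "AE \<omega> in M. norm (?e n \<omega>) \<le> B"
    proof (rule AE_I2)
      fix \<omega>
      have "\<bar>?e n \<omega>\<bar> \<le> measure_pmf.expectation (record_vec (n - m) m) (\<lambda>z :: 'd \<Rightarrow> nat. B)"
        by (intro order_trans[OF integral_abs_bound] integral_mono integrable_measure_pmf_finite finite_set_record_vec B)
      then show "norm (?e n \<omega>) \<le> B" by simp
    qed
    show "?e n \<in> borel_measurable M"
      by (rule borel_measurable_integrable, rule integrable_tree)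
  qed auto
  then show ?thesis unfolding interpolant_def by (simp add: prob_space)
qed

theorem exit_depths_converge:
  fixes u :: "'d::finite \<Rightarrow> nat \<Rightarrow> bool" and f :: "real ^ 'd \<Rightarrow> real"
  assumes u: "inj u" and f: "continuous_on UNIV f" "bounded (range f)"
  shows "(\<lambda>n. expectation (\<lambda>\<omega>. f (\<chi> l. (real (exit_depth (tree n \<omega>) (u l)) - ln (real n)) / sqrt (ln (real n)))))
    \<longlonglongrightarrow> (\<integral>x. f x \<partial>std_normal_vec)"
proof -
  obtain B where B: "\<And>x. \<bar>f x\<bar> \<le> B" using f(2) by (auto simp: bounded_iff)
  obtain K where K: "\<And>l l'. l \<noteq> l' \<Longrightarrow> \<exists>k<K. u l k \<noteq> u l' k" using uniform_separation[OF u] by blast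
  define C where "C = 2 ^ CARD('d) * real CARD('d) + (real CARD('d) + 2 ^ CARD('d)) * (real CARD('d) * 2 ^ K)"
  define h where "h n D = f (\<chi> l. (real (D l) - ln (real n)) / sqrt (ln (real n)))" for n :: nat and D :: "'d \<Rightarrow> nat"
  let ?a = "\<lambda>i. 1 / (real (Suc i) * sqrt (real (Suc i)))"
  have B0: "0 \<le> B" using B[of 0] by simp
  have C0: "0 \<le> C" by (simp add: C_def)
  have "(\<lambda>n. interpolant u (h n) 0 n) \<longlonglongrightarrow> (\<integral>x. f x \<partial>std_normal_vec)" (is "_ \<longlonglongrightarrow> ?N")
  proof (rule LIMSEQ_I)
    fix r :: real assume r: "r > 0"
    \<comment> \<open>Adding one avoids a division by zero when \<open>B = 0\<close>.\<close>
    let ?r = "r / 2 / (2 * B * C + 1)"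
    have "?r > 0" using r B0 C0 by (intro divide_pos_pos add_nonneg_pos) auto
    then obtain m where m: "norm (\<Sum>i. ?a (i + m)) < ?r"
      using suminf_exist_split[OF _ summable_inverse_three_halves] by blast
    have "2 * B * C * (\<Sum>i. ?a (i + m)) \<le> 2 * B * C * ?r"
      by (intro mult_left_mono) (use m B0 C0 in auto)
    also have "\<dots> \<le> (2 * B * C + 1) * ?r" using \<open>?r > 0\<close> by (intro mult_right_mono) auto
    also have "\<dots> = r / 2"
    proof -
      have "c * (r / 2 / c) = r / 2" if "c > 0" for c :: real using that by simp
      moreover have "2 * B * C + 1 > 0" using B0 C0 by (intro add_nonneg_pos) auto
      ultimately show ?thesis by blast
    qed
    finally have tail: "2 * B * C * (\<Sum>i. ?a (i + m)) \<le> r / 2" .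
    have "(\<lambda>n. interpolant u (h n) (n - m) m) \<longlonglongrightarrow> ?N"
      unfolding h_def by (rule interpolant_limit[OF f])
    then have "\<exists>N. \<forall>n\<ge>N. norm (interpolant u (h n) (n - m) m - ?N) < r / 2"
      by (rule LIMSEQ_D) (use r in simp)
    then obtain N where N: "\<And>n. n \<ge> N \<Longrightarrow> norm (interpolant u (h n) (n - m) m - ?N) < r / 2"
      by blast
    show "\<exists>N. \<forall>n\<ge>N. norm (interpolant u (h n) 0 n - ?N) < r"
    proof (intro exI allI impI)
      fix n assume n: "max N m \<le> n"
      have "\<bar>interpolant u (h n) 0 n - interpolant u (h n) (n - m) m\<bar> \<le> 2 * B * C * (\<Sum>i. ?a (i + m))"
        unfolding C_def by (rule interpolant_diff[OF _ K]) (use n B in \<open>auto simp: h_def\<close>)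
      then show "norm (interpolant u (h n) 0 n - ?N) < r"
        using tail N[of n] n unfolding real_norm_def by linarith
    qed
  qed
  then show ?thesis by (simp add: interpolant_def record_vec_0 h_def)
qed

end

theorem theorem1:
  fixes M :: "'a measure"
    and T :: "nat \<Rightarrow> 'a \<Rightarrow> node set"
    and s :: "'d::{finite,linorder} \<Rightarrow> real"
  assumes "BST_sequence M T"
    and "\<And>l. 0 \<le> s l" and "\<And>l. s l \<le> 1"
    and "strict_mono s"
  shows "converges_in_distribution M
           (\<lambda>n \<omega>. \<chi> l. (real (silhouette (T n \<omega>) (s l)) - ln (real n)) / sqrt (ln (real n)))
           std_normal_vec"
proof -
  let ?Y = "\<lambda>n \<omega>. \<chi> l. (real (silhouette (T n \<omega>) (s l)) - ln (real n)) / sqrt (ln (real n))"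
  define u where "u l = binary_digits (s l)" for l
  have "inj u"
  proof (rule injI)
    fix l l' assume "u l = u l'"
    then have "s l = s l'" using assms(2,3) by (intro binary_digits_inj) (auto simp: u_def)
    then show "l = l'" using strict_mono_imp_inj_on[OF assms(4)] by (simp add: inj_eq)
  qed
  obtain \<xi> where \<xi>: "prob_space M" "prob_space.indep_vars M (\<lambda>_. borel) \<xi> {1..}"
    "\<And>n. n \<ge> 1 \<Longrightarrow> distr M lborel (\<xi> n) = uniform_measure lborel {0..1}"
    "\<And>n \<omega>. n \<ge> 1 \<Longrightarrow> \<omega> \<in> space M \<Longrightarrow> T n \<omega> = dom (bst_of_keys (\<lambda>i. \<xi> i \<omega>) n)"
    using assms(1) unfolding BST_sequence_def by blast
  interpret prob_space M by fact
  interpret iid_keys M \<xi> by unfold_locales (use \<xi> in auto)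
  show ?thesis unfolding converges_in_distribution_def
  proof (intro allI impI)
    fix f :: "(real, 'd) vec \<Rightarrow> real" assume "continuous_on UNIV f \<and> bounded (range f)"
    then have f: "continuous_on UNIV f" "bounded (range f)" by auto
    \<comment> \<open>The trees need to agree with those of the keys only on the space of \<open>M\<close> and for \<open>n \<ge> 1\<close>.\<close>
    let ?Z = "\<lambda>n \<omega>. \<chi> l. (real (exit_depth (tree n \<omega>) (u l)) - ln (real n)) / sqrt (ln (real n))"
    have "\<forall>\<^sub>F n in sequentially. expectation (\<lambda>\<omega>. f (?Z n \<omega>)) = (\<integral>y. f y \<partial>distr M borel (?Y n))"
      using eventually_ge_at_top[of 1]
    proof eventually_elim
      case (elim n)
      have eq: "?Z n \<omega> = ?Y n \<omega>" if "\<omega> \<in> space M" for \<omega>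
        using \<xi>(4)[OF elim that] by (simp add: silhouette_eq_exit_depth u_def)
      have "?Z n \<in> M \<rightarrow>\<^sub>M borel"
        by (rule measurable_compose[OF tree_measurable]) simp
      then have meas: "?Y n \<in> M \<rightarrow>\<^sub>M borel" using measurable_cong[of M "?Z n" "?Y n" borel] eq by blast
      have "(\<integral>y. f y \<partial>distr M borel (?Y n)) = expectation (\<lambda>\<omega>. f (?Y n \<omega>))"
        by (rule integral_distr[OF meas]) (rule borel_measurable_continuous_onI[OF f(1)])
      also have "\<dots> = expectation (\<lambda>\<omega>. f (?Z n \<omega>))"
        by (rule Bochner_Integration.integral_cong[OF refl]) (simp only: eq)
      finally show ?case ..
    qed
    then show "(\<lambda>n. \<integral>y. f y \<partial>distr M borel (?Y n)) \<longlonglongrightarrow> (\<integral>y. f y \<partial>std_normal_vec)"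
      using exit_depths_converge[OF \<open>inj u\<close> f] by (rule Lim_transform_eventually[rotated])
  qed
qed

end
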